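(* Fix $d\geq 2$ and let $\varepsilon>0$ and $0<\eta<1/2$ be numbers such that every distance-regular graph of diameter $d$ satisfies at least one of: (1) $b_i\geq \varepsilon k$ and $c_{i+1}\geq \varepsilon k$ for some $0\le i\le d-1$; (2) its zero-weight spectral radius is at most $k(1-\eta)$. Let $X$ be a geometric distance-regular graph of diameter $d$ on $n$ vertices with $\mu=1$ and smallest eigenvalue $-m$, where $m\geq 3$. Assume $c_t\leq\varepsilon k$ and $b_t\leq \varepsilon k$ for some $t\in\{1,\dots,d\}$, and $k\geq \max(4m/\eta, m^2)$. Then $\mathrm{motion}(X)\geq \frac{\eta}{4}n$.
   Context: A connected graph of diameter $d$ is distance-regular if for each $0\le i\le d$ there are constants $a_i,b_i,c_i$ such that for any vertices $v,w$ at distance $i$, $w$ has exactly $c_i$, $a_i$, $b_i$ neighbors at distance $i-1$, $i$, $i+1$ from $v$; $k=b_0$, $\mu=c_2$. For a $k$-regular graph with adjacency eigenvalues $k=\xi_1\ge\xi_2\ge\dots\ge\xi_n$, the zero-weight spectral radius is $\max_{2\le i\le n}|\xi_i|$. A Delsarte clique is a clique of size $1-k/\theta_{\min}$ where $\theta_{\min}$ is the smallest eigenvalue; $X$ is geometric if there is a collection of Delsarte cliques such that every edge lies in exactly one of them. $\mathrm{motion}(X)$ is the minimum number of vertices moved by a non-identity automorphism of $X$. (Constants $\varepsilon,\eta$ as in the claim exist for every $d$ by earlier work of the author.) *)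

theory Defs
  imports
    "Graph_Theory.Graph_Theory"
    "Jordan_Normal_Form.Char_Poly"
    "HOL-Computational_Algebra.Polynomial"
    "HOL-Combinatorics.Permutations"
    "HOL-Library.Extended_Real"
begin

text \<open>
  A finite simple graph is a \<^term>\<open>pair_graph\<close>: finite vertex set \<^term>\<open>pverts G\<close>, symmetric
  irreflexive arc relation \<^term>\<open>parcs G\<close>. An edge is a pair of opposite arcs.
\<close>

definition graph_dist :: "'a pair_pre_digraph \<Rightarrow> 'a \<Rightarrow> 'a \<Rightarrow> nat" where
  "graph_dist G u v = (LEAST l. \<exists>p. pre_digraph.awalk (with_proj G) u p v \<and> length p = l)"

definition graph_diameter :: "'a pair_pre_digraph \<Rightarrow> nat" where
  "graph_diameter G = Max {graph_dist G u v |u v. u \<in> pverts G \<and> v \<in> pverts G}"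

text \<open>
  Only the values \<open>a i\<close>, \<open>b i\<close>, \<open>c i\<close> with \<open>i \<le> d\<close> are constrained. The condition
  \<open>graph_dist G v u + 1 = i\<close> avoids truncated subtraction, so \<open>c 0 = 0\<close>; also \<open>b d = 0\<close>, and
  \<open>b 0\<close> is the valency.
\<close>

definition distance_regular ::
  "'a pair_pre_digraph \<Rightarrow> nat \<Rightarrow> (nat \<Rightarrow> nat) \<Rightarrow> (nat \<Rightarrow> nat) \<Rightarrow> (nat \<Rightarrow> nat) \<Rightarrow> bool" where
  "distance_regular G d a b c \<longleftrightarrow>
     pair_graph G \<and> connected (with_proj G) \<and> graph_diameter G = d \<and>
     (\<forall>i\<le>d. \<forall>v\<in>pverts G. \<forall>w\<in>pverts G. graph_dist G v w = i \<longrightarrow>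
        card {u. (w, u) \<in> parcs G \<and> graph_dist G v u + 1 = i} = c i \<and>
        card {u. (w, u) \<in> parcs G \<and> graph_dist G v u = i} = a i \<and>
        card {u. (w, u) \<in> parcs G \<and> graph_dist G v u = i + 1} = b i)"

text \<open>
  Matrices are indexed by initial segments of the naturals, so an arbitrary enumeration of the
  vertices is fixed; the eigenvalues and their multiplicities do not depend on it.
\<close>

definition vertex_enum :: "'a pair_pre_digraph \<Rightarrow> 'a list" where
  "vertex_enum G = (SOME vs. distinct vs \<and> set vs = pverts G)"

definition adj_matrix :: "'a pair_pre_digraph \<Rightarrow> real mat" where
  "adj_matrix G = mat (card (pverts G)) (card (pverts G))
     (\<lambda>(i, j). if (vertex_enum G ! i, vertex_enum G ! j) \<in> parcs G then 1 else 0)"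

text \<open>
  The non-increasing list \<open>\<xi>\<^sub>1 \<ge> \<dots> \<ge> \<xi>\<^sub>n\<close> of eigenvalues with multiplicity (all roots of the
  characteristic polynomial are real, the matrix being symmetric); \<open>\<xi>\<^sub>i\<close> is entry \<open>i - 1\<close>.
\<close>

definition graph_eigenvalues :: "'a pair_pre_digraph \<Rightarrow> real list" where
  "graph_eigenvalues G = rev (sorted_list_of_multiset (proots (char_poly (adj_matrix G))))"

definition zero_weight_spectral_radius :: "'a pair_pre_digraph \<Rightarrow> real" where
  "zero_weight_spectral_radius G =
     Max {\<bar>graph_eigenvalues G ! i\<bar> |i. 1 \<le> i \<and> i < length (graph_eigenvalues G)}"

definition smallest_eigenvalue :: "'a pair_pre_digraph \<Rightarrow> real" where
  "smallest_eigenvalue G = Min {\<theta>. eigenvalue (adj_matrix G) \<theta>}"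

definition graph_clique :: "'a pair_pre_digraph \<Rightarrow> 'a set \<Rightarrow> bool" where
  "graph_clique G C \<longleftrightarrow> C \<subseteq> pverts G \<and> (\<forall>u\<in>C. \<forall>v\<in>C. u \<noteq> v \<longrightarrow> (u, v) \<in> parcs G)"

text \<open>In the next two definitions \<open>k\<close> stands for the valency of \<open>G\<close>.\<close>

definition delsarte_clique :: "'a pair_pre_digraph \<Rightarrow> nat \<Rightarrow> 'a set \<Rightarrow> bool" where
  "delsarte_clique G k C \<longleftrightarrow>
     graph_clique G C \<and> real (card C) = 1 - real k / smallest_eigenvalue G"

definition geometric :: "'a pair_pre_digraph \<Rightarrow> nat \<Rightarrow> bool" where
  "geometric G k \<longleftrightarrow>
     (\<exists>\<C>. (\<forall>C\<in>\<C>. delsarte_clique G k C) \<and>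
          (\<forall>(u, v)\<in>parcs G. \<exists>!C. C \<in> \<C> \<and> u \<in> C \<and> v \<in> C))"

definition graph_automorphisms :: "'a pair_pre_digraph \<Rightarrow> ('a \<Rightarrow> 'a) set" where
  "graph_automorphisms G =
     {\<sigma>. \<sigma> permutes pverts G \<and>
         (\<forall>u\<in>pverts G. \<forall>v\<in>pverts G. (\<sigma> u, \<sigma> v) \<in> parcs G \<longleftrightarrow> (u, v) \<in> parcs G)}"

text \<open>
  The motion of a graph whose only automorphism is the identity is the infimum of the empty
  set, that is, infinity.
\<close>

definition motion :: "'a pair_pre_digraph \<Rightarrow> enat" where
  "motion G =
     (INF \<sigma>\<in>graph_automorphisms G - {id}. enat (card {v \<in> pverts G. \<sigma> v \<noteq> v}))"

end

theory Submission
  imports Defs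
begin

text \<open>
  Let \<open>S\<close> and \<open>F\<close> be the sets of vertices moved and fixed by an automorphism \<open>\<sigma> \<noteq> id\<close>, and let
  \<open>k\<close> be the valency. Two estimates for the number \<open>e(S, F)\<close> of edges between them are played
  against each other.

  In a distance-regular graph the probability that a random pair at distance \<open>i\<close> is separated by
  \<open>S\<close> is subadditive in \<open>i\<close>, whence \<open>k |S| |F| \<le> d n e(S, F)\<close>.

  A fixed neighbour of \<open>v \<in> S\<close> is a common neighbour of \<open>v\<close> and \<open>\<sigma> v\<close>. As \<open>\<mu> = 1\<close>, there is at
  most one, unless \<open>v\<close> and \<open>\<sigma> v\<close> are adjacent and there are at most \<open>a\<^sub>1\<close>; since the neighbourhood
  of a vertex is a disjoint union of cliques of size \<open>a\<^sub>1 + 1\<close>, the exceptional \<open>v\<close> are so sparse in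
  \<open>S\<close> that \<open>e(S, F) \<le> 3 |S|\<close>. Thus \<open>k |F| \<le> 3 d n\<close>.

  Finally \<open>k \<ge> 6 d\<close>: the Hamming graph \<open>H(d, q)\<close> violates the first alternative of the hypothesis
  on \<open>\<epsilon>\<close> and \<open>\<eta>\<close> for large \<open>q\<close>, so its eigenvalue \<open>(d - 1) (q - 1) - 1\<close> forces \<open>\<eta> d \<le> 2\<close>, and
  \<open>k \<ge> 4 m / \<eta> \<ge> 12 / \<eta>\<close>.
\<close>

subsection \<open>Distances\<close>

text \<open>Distances are handled through relational powers of the arc relation, where walks can be
  extended at either end.\<close>

lemma (in pair_graph) awalk_length_iff_relpow:
  assumes "u \<in> pverts G"
  shows "(\<exists>p. awalk u p v \<and> length p = l) \<longleftrightarrow> (u, v) \<in> parcs G ^^ l"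
  using assms
proof (induction l arbitrary: u)
  case 0
  then show ?case by (auto simp: awalk_Nil_iff)
next
  case (Suc l)
  have "(\<exists>p. awalk u p v \<and> length p = Suc l) \<longleftrightarrow>
      (\<exists>w. (u, w) \<in> parcs G \<and> (\<exists>p. awalk w p v \<and> length p = l))"
  proof safe
    fix p assume p: "awalk u p v" "length p = Suc l"
    then obtain e q where "p = e # q" by (cases p) auto
    with p show "\<exists>w. (u, w) \<in> parcs G \<and> (\<exists>p. awalk w p v \<and> length p = l)"
      by (intro exI[of _ "snd e"] conjI exI[of _ q]) (auto simp: awalk_Cons_iff)
  next
    fix w p assume "(u, w) \<in> parcs G" "awalk w p v" "l = length p"
    then show "\<exists>q. awalk u q v \<and> length q = Suc (length p)"
      by (intro exI[of _ "(u, w) # p"]) (simp add: awalk_Cons_iff)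
  qed
  also have "\<dots> \<longleftrightarrow> (\<exists>w. (u, w) \<in> parcs G \<and> (w, v) \<in> parcs G ^^ l)"
    using Suc.IH in_arcsD2 by blast
  finally show ?case
    unfolding relpow.simps(2) relpow_commute[symmetric] by blast
qed

lemma (in pair_graph) graph_dist_relpow:
  "u \<in> pverts G \<Longrightarrow> graph_dist G u v = (LEAST l. (u, v) \<in> parcs G ^^ l)"
  unfolding graph_dist_def using awalk_length_iff_relpow by simp

lemma (in pair_graph) parcs_sym: "(u, v) \<in> parcs G \<Longrightarrow> (v, u) \<in> parcs G"
  using pair_sym_arcs by (auto simp: symmetric_def sym_def)

lemma (in pair_graph) parcs_neq: "(u, v) \<in> parcs G \<Longrightarrow> u \<noteq> v"
  using pair_no_loops by force

lemma (in pair_graph) relpow_parcs_sym: "(u, v) \<in> parcs G ^^ l \<Longrightarrow> (v, u) \<in> parcs G ^^ l"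
proof (induction l arbitrary: v)
  case (Suc l)
  then obtain w where "(u, w) \<in> parcs G ^^ l" "(w, v) \<in> parcs G" by auto
  then show ?case using Suc.IH parcs_sym by (metis relpow_Suc_I2)
qed auto

text \<open>Connectedness is reachability in the symmetric closure, and the arc relation is already
  symmetric.\<close>

lemma (in pair_graph) connected_iff_relpow:
  "connected (with_proj G) \<longleftrightarrow>
     pverts G \<noteq> {} \<and> (\<forall>u\<in>pverts G. \<forall>v\<in>pverts G. \<exists>l. (u, v) \<in> parcs G ^^ l)"
proof -
  have r: "(u \<rightarrow>\<^sup>*\<^bsub>with_proj (mk_symmetric (with_proj G))\<^esub> v) = (\<exists>l. (u, v) \<in> parcs G ^^ l)"
    if "u \<in> pverts G" for u v
    using reachable_mk_symmetric_eq[of u v] reachable_awalk awalk_length_iff_relpow[OF that, of v]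
      pair_sym_arcs by metis
  have "pverts (mk_symmetric (with_proj G)) = pverts G"
    by (simp add: mk_symmetric_def)
  then show ?thesis
    using r by (simp add: connected_def strongly_connected_def)
qed

text \<open>By \<open>step\<close>, a walk of length \<open>l\<close> from \<open>u\<close> ends
  where \<open>f\<close> is at most \<open>l\<close>; by \<open>pred\<close>, a walk of length
  \<open>f v\<close> can be traced back from \<open>v\<close> to \<open>u\<close>. This later
  identifies graph distance with Hamming distance.\<close>

lemma (in pair_graph) graph_dist_eqI:
  assumes zero: "\<And>v. v \<in> pverts G \<Longrightarrow> f v = 0 \<longleftrightarrow> u = v"
    and step: "\<And>v w. (w, v) \<in> parcs G \<Longrightarrow> f v \<le> f w + (1::nat)"
    and pred: "\<And>v l. v \<in> pverts G \<Longrightarrow> f v = Suc l \<Longrightarrow> \<exists>w. (w, v) \<in> parcs G \<and> f w = l"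
    and u: "u \<in> pverts G" and v: "v \<in> pverts G"
  shows "(u, v) \<in> parcs G ^^ f v" and "graph_dist G u v = f v"
proof -
  have "(u, v) \<in> parcs G ^^ l" if "f v = l" "v \<in> pverts G" for l v
    using that
  proof (induction l arbitrary: v)
    case (Suc l)
    then obtain w where "(w, v) \<in> parcs G" "f w = l" using pred by blast
    then show ?case using Suc.IH[of w] in_arcsD1 by auto
  qed (use zero in auto)
  then show walk: "(u, v) \<in> parcs G ^^ f v" using v by simp
  have "f v \<le> l" if "(u, v) \<in> parcs G ^^ l" for l v
    using that
  proof (induction l arbitrary: v)
    case (Suc l)
    then obtain w where "(u, w) \<in> parcs G ^^ l" "(w, v) \<in> parcs G" by auto
    then show ?case using Suc.IH[of w] step by fastforce
  qed (use zero u in auto)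
  then show "graph_dist G u v = f v"
    using walk u by (simp add: graph_dist_relpow Least_equality)
qed

section \<open>Distances in a distance-regular graph\<close>

locale drg =
  fixes G :: "'a pair_pre_digraph" and d :: nat and a b c :: "nat \<Rightarrow> nat"
  assumes dr: "distance_regular G d a b c"
begin

sublocale pair_graph G using dr by (simp only: distance_regular_def)

abbreviation "V \<equiv> pverts G"
abbreviation "\<delta> \<equiv> graph_dist G"

lemma connected: "connected (with_proj G)"
  using dr by (simp only: distance_regular_def)

lemma diameter: "graph_diameter G = d"
  using dr by (simp only: distance_regular_def)

lemma nonempty: "V \<noteq> {}"
  using connected unfolding connected_iff_relpow by (elim conjE)

lemma dist_relpow: "u \<in> V \<Longrightarrow> v \<in> V \<Longrightarrow> (u, v) \<in> parcs G ^^ \<delta> u v"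
proof -
  assume uv: "u \<in> V" "v \<in> V"
  then obtain l where "(u, v) \<in> parcs G ^^ l"
    using connected unfolding connected_iff_relpow by blast
  then show ?thesis unfolding graph_dist_relpow[OF uv(1)] by (rule LeastI)
qed

lemma dist_le: "u \<in> V \<Longrightarrow> (u, v) \<in> parcs G ^^ l \<Longrightarrow> \<delta> u v \<le> l"
  by (simp add: graph_dist_relpow Least_le)

lemma dist_sym: "u \<in> V \<Longrightarrow> v \<in> V \<Longrightarrow> \<delta> u v = \<delta> v u"
  using dist_le[OF _ relpow_parcs_sym[OF dist_relpow]] by (metis le_antisym)

lemma dist_0_iff: "u \<in> V \<Longrightarrow> v \<in> V \<Longrightarrow> \<delta> u v = 0 \<longleftrightarrow> u = v"
  using dist_relpow[of u v] dist_le[of u v 0] by auto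

lemma dist_1_iff: "u \<in> V \<Longrightarrow> v \<in> V \<Longrightarrow> \<delta> u v = Suc 0 \<longleftrightarrow> (u, v) \<in> parcs G"
proof
  assume "u \<in> V" "v \<in> V" "\<delta> u v = Suc 0"
  then show "(u, v) \<in> parcs G" using dist_relpow[of u v] by simp
next
  assume uv: "u \<in> V" "v \<in> V" "(u, v) \<in> parcs G"
  then have "\<delta> u v \<le> 1" by (intro dist_le) auto
  moreover have "\<delta> u v \<noteq> 0" using uv dist_0_iff parcs_neq by blast
  ultimately show "\<delta> u v = Suc 0" by simp
qed

lemma dist_step: "u \<in> V \<Longrightarrow> (w, v) \<in> parcs G \<Longrightarrow> \<delta> u v \<le> Suc (\<delta> u w)"
  using dist_relpow[of u w] by (intro dist_le) (auto intro: in_arcsD1)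

lemma dist_pred:
  assumes "u \<in> V" "v \<in> V" "\<delta> u v = Suc l"
  obtains w where "(w, v) \<in> parcs G" "\<delta> u w = l"
proof -
  obtain w where w: "(u, w) \<in> parcs G ^^ l" "(w, v) \<in> parcs G"
    using dist_relpow[of u v] assms by auto
  then have "\<delta> u w = l"
    using dist_le[of u w l] dist_step[of u w v] assms by fastforce
  with w that show ?thesis by blast
qed

lemma dist_le_diameter: "u \<in> V \<Longrightarrow> v \<in> V \<Longrightarrow> \<delta> u v \<le> d"
proof -
  assume uv: "u \<in> V" "v \<in> V"
  have "{\<delta> u v |u v. u \<in> V \<and> v \<in> V} = case_prod \<delta> ` (V \<times> V)" by auto
  then have "finite {\<delta> u v |u v. u \<in> V \<and> v \<in> V}" using pair_finite_verts by simp
  then have "\<delta> u v \<le> graph_diameter G"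
    unfolding graph_diameter_def using uv by (intro Max_ge) auto
  then show ?thesis by (simp add: diameter)
qed

lemma diameter_attained: obtains u v where "u \<in> V" "v \<in> V" "\<delta> u v = d"
proof -
  have "{\<delta> u v |u v. u \<in> V \<and> v \<in> V} = case_prod \<delta> ` (V \<times> V)" by auto
  then have "finite {\<delta> u v |u v. u \<in> V \<and> v \<in> V}" "{\<delta> u v |u v. u \<in> V \<and> v \<in> V} \<noteq> {}"
    using pair_finite_verts nonempty by auto
  from Max_in[OF this] have "graph_diameter G \<in> {\<delta> u v |u v. u \<in> V \<and> v \<in> V}"
    by (simp add: graph_diameter_def)
  then show ?thesis using that unfolding diameter by blast
qed

text \<open>Start from a pair at distance \<open>d\<close> and move one end backwards along a
  geodesic.\<close>

lemma dist_attained: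
  assumes "l \<le> d" obtains u v where "u \<in> V" "v \<in> V" "\<delta> u v = l"
proof -
  have "\<exists>u\<in>V. \<exists>v\<in>V. \<delta> u v = l" using assms
  proof (induction rule: inc_induct)
    case base
    then show ?case using diameter_attained by blast
  next
    case (step n)
    then show ?case by (metis dist_pred in_arcsD1)
  qed
  then show ?thesis using that by blast
qed

lemma
  assumes "v \<in> V" "w \<in> V"
  shows card_c: "card {u. (w, u) \<in> parcs G \<and> \<delta> v u + 1 = \<delta> v w} = c (\<delta> v w)"
    and card_a: "card {u. (w, u) \<in> parcs G \<and> \<delta> v u = \<delta> v w} = a (\<delta> v w)"
    and card_b: "card {u. (w, u) \<in> parcs G \<and> \<delta> v u = \<delta> v w + 1} = b (\<delta> v w)"
  using dr assms dist_le_diameter[OF assms] unfolding distance_regular_def by auto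

lemma valency: "v \<in> V \<Longrightarrow> card {u. (v, u) \<in> parcs G} = b 0"
proof -
  assume v: "v \<in> V"
  have "{u. (v, u) \<in> parcs G \<and> \<delta> v u = \<delta> v v + 1} = {u. (v, u) \<in> parcs G}"
    using dist_1_iff[OF v] dist_0_iff[OF v v] in_arcsD2 by auto
  then show ?thesis using card_b[OF v v] dist_0_iff[OF v v] by simp
qed

end

subsection \<open>Edge isoperimetry in distance-regular graphs\<close>

context drg
begin

text \<open>These are the entries of the distance-\<open>i\<close> matrix \<open>A_i\<close>. Matrix
  products are written out as sums over \<open>V\<close>, which avoids enumerating the
  vertices.\<close>

definition dind :: "nat \<Rightarrow> 'a \<Rightarrow> 'a \<Rightarrow> real" where
  "dind i x y = of_bool (\<delta> x y = i)"

lemma dind_sym: "x \<in> V \<Longrightarrow> y \<in> V \<Longrightarrow> dind i x y = dind i y x"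
  by (simp add: dind_def dist_sym)

lemma dind_nonneg [simp]: "0 \<le> dind i x y"
  by (simp add: dind_def)

lemma sum_dind_0: "x \<in> V \<Longrightarrow> (\<Sum>u\<in>V. dind 0 x u * f u) = f x"
proof -
  assume x: "x \<in> V"
  have "(\<Sum>u\<in>V. dind 0 x u * f u) = (\<Sum>u\<in>V. if u = x then f x else 0)"
    by (rule sum.cong) (use x dist_0_iff in \<open>auto simp: dind_def\<close>)
  then show ?thesis using x pair_finite_verts by simp
qed

text \<open>In matrix form, \<open>A_i A_1 = b_(i-1) A_(i-1) + a_i A_i + c_(i+1) A_(i+1)\<close>. An
  entry counts the neighbours of \<open>y\<close> at distance \<open>i\<close> from
  \<open>x\<close>, and there are none unless \<open>x\<close> and \<open>y\<close> are at distance
  \<open>i - 1\<close>, \<open>i\<close> or \<open>i + 1\<close>. The case \<open>i = 0\<close> is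
  split off because \<open>i - 1\<close> truncates.\<close>

lemma three_term:
  assumes x: "x \<in> V" and y: "y \<in> V"
  shows "(\<Sum>w\<in>V. dind i x w * dind 1 w y) =
    (if i = 0 then 0 else b (i - 1) * dind (i - 1) x y) + a i * dind i x y
      + c (i + 1) * dind (i + 1) x y"
proof -
  have "(\<Sum>w\<in>V. dind i x w * dind 1 w y) = (\<Sum>w\<in>V. of_bool ((y, w) \<in> parcs G \<and> \<delta> x w = i))"
    by (rule sum.cong) (use y dist_1_iff parcs_sym in \<open>auto simp: dind_def\<close>)
  also have "\<dots> = card (V \<inter> {w. (y, w) \<in> parcs G \<and> \<delta> x w = i})"
    using pair_finite_verts by (simp add: of_bool_def sum.If_cases)
  also have "V \<inter> {w. (y, w) \<in> parcs G \<and> \<delta> x w = i} = {w. (y, w) \<in> parcs G \<and> \<delta> x w = i}"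
    using in_arcsD2 by auto
  finally have *: "(\<Sum>w\<in>V. dind i x w * dind 1 w y) =
    card {w. (y, w) \<in> parcs G \<and> \<delta> x w = i}" .
  consider "i = \<delta> x y + 1" | "i = \<delta> x y" | "i + 1 = \<delta> x y"
    | "i \<noteq> \<delta> x y + 1" "i \<noteq> \<delta> x y" "i + 1 \<noteq> \<delta> x y" by blast
  then show ?thesis
  proof cases
    case 1
    then show ?thesis using card_b[OF x y] unfolding * by (simp add: dind_def)
  next
    case 2
    then show ?thesis using card_a[OF x y] unfolding * by (auto simp: dind_def)
  next
    case 3
    then have "{w. (y, w) \<in> parcs G \<and> \<delta> x w = i} = {w. (y, w) \<in> parcs G \<and> \<delta> x w + 1 = \<delta> x y}"
      by auto
    then show ?thesis using card_c[OF x y] 3 unfolding * by (auto simp: dind_def)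
  next
    case 4
    have "(y, w) \<in> parcs G \<Longrightarrow> \<delta> x w \<noteq> i" for w
      using dist_step[OF x, of y w] dist_step[OF x, of w y] parcs_sym 4 by fastforce
    then have "{w. (y, w) \<in> parcs G \<and> \<delta> x w = i} = {}" by blast
    then have "card {w. (y, w) \<in> parcs G \<and> \<delta> x w = i} = 0" by (simp only: card.empty)
    then show ?thesis using 4 unfolding * by (auto simp: dind_def)
  qed
qed

text \<open>The predecessor of \<open>y\<close> on a geodesic from \<open>x\<close> is among the
  vertices counted. Positivity permits division by \<open>c (Suc i)\<close> below.\<close>

lemma c_pos:
  assumes x: "x \<in> V" and y: "y \<in> V" and d: "\<delta> x y = Suc i"
  shows "0 < c (Suc i)"
proof -
  obtain w where w: "(w, y) \<in> parcs G" "\<delta> x w = i" using dist_pred[OF x y d] .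
  have "{u. (y, u) \<in> parcs G \<and> \<delta> x u + 1 = Suc i} \<subseteq> V" using in_arcsD2 by auto
  then have "finite {u. (y, u) \<in> parcs G \<and> \<delta> x u + 1 = Suc i}"
    using pair_finite_verts finite_subset by blast
  moreover have "w \<in> {u. (y, u) \<in> parcs G \<and> \<delta> x u + 1 = Suc i}" using w parcs_sym by auto
  ultimately have "0 < card {u. (y, u) \<in> parcs G \<and> \<delta> x u + 1 = Suc i}"
    using card_gt_0_iff by blast
  then show ?thesis using card_c[OF x y] d by simp
qed

text \<open>
  Multiplying the three-term recurrence for the distance matrix of index \<open>i\<close> by the one of index
  \<open>j\<close> expresses level \<open>i + 1\<close> through levels \<open>i\<close> and \<open>i - 1\<close>.
\<close>

lemma intersection_numbers:
  "\<exists>f. \<forall>x\<in>V. \<forall>y\<in>V. (\<Sum>u\<in>V. dind i x u * dind j u y) = f (\<delta> x y)"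
proof (induction i arbitrary: j rule: less_induct)
  case (less i)
  show ?case
  proof (cases i)
    case 0
    have "\<forall>x\<in>V. \<forall>y\<in>V. (\<Sum>u\<in>V. dind i x u * dind j u y) = of_bool (\<delta> x y = j)"
      using 0 by (simp add: sum_dind_0) (simp add: dind_def)
    then show ?thesis by (rule exI[of _ "\<lambda>l. of_bool (l = j)"])
  next
    case (Suc i')
    show ?thesis
    \<comment> \<open>If the distance \<open>i\<close> does not occur, \<open>dind i\<close>
      vanishes; if it does, \<open>c (Suc i')\<close> is nonzero.\<close>
    proof (cases "\<exists>x\<in>V. \<exists>y\<in>V. \<delta> x y = Suc i'")
      case False
      then have "\<forall>x\<in>V. \<forall>y\<in>V. (\<Sum>u\<in>V. dind i x u * dind j u y) = 0"
        using Suc by (auto simp: dind_def)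
      then show ?thesis by (rule exI[of _ "\<lambda>_. 0"])
    next
      case True
      then have c: "c (Suc i') \<noteq> 0" using c_pos by blast
      have "\<exists>F. \<forall>j. \<forall>x\<in>V. \<forall>y\<in>V. (\<Sum>u\<in>V. dind i' x u * dind j u y) = F j (\<delta> x y)"
        using less[of i'] Suc by (intro choice allI) simp
      then obtain F where F: "\<And>j x y. x \<in> V \<Longrightarrow> y \<in> V \<Longrightarrow>
        (\<Sum>u\<in>V. dind i' x u * dind j u y) = F j (\<delta> x y)" by blast
      have "\<exists>H. \<forall>x\<in>V. \<forall>y\<in>V. (if i' = 0 then 0 else b (i' - 1) *
          (\<Sum>u\<in>V. dind (i' - 1) x u * dind j u y)) = H (\<delta> x y)"
      proof (cases "i' = 0")
        case False
        obtain f where "\<And>x y. x \<in> V \<Longrightarrow> y \<in> V \<Longrightarrow>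
          (\<Sum>u\<in>V. dind (i' - 1) x u * dind j u y) = f (\<delta> x y)"
          using less[of "i' - 1" j] Suc by (metis diff_le_self le_imp_less_Suc)
        then show ?thesis using False by (intro exI[of _ "\<lambda>l. b (i' - 1) * f l"]) auto
      qed auto
      then obtain H where H: "\<And>x y. x \<in> V \<Longrightarrow> y \<in> V \<Longrightarrow> (if i' = 0 then 0 else b (i' - 1) *
          (\<Sum>u\<in>V. dind (i' - 1) x u * dind j u y)) = H (\<delta> x y)" by blast
      \<comment> \<open>\<open>P\<close> gives the entries of \<open>A_i' A_1 A_j\<close> bracketed
        as \<open>A_i' (A_1 A_j)\<close>. Bracketing it as \<open>(A_i' A_1) A_j\<close> instead
        produces the product sought with coefficient \<open>c (Suc i')\<close>, next to terms known
        by induction, so the equation can be solved for it.\<close>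
      define P where "P l = (if j = 0 then 0 else b (j - 1) * F (j - 1) l) + a j * F j l
        + c (j + 1) * F (j + 1) l" for l
      have "(\<Sum>u\<in>V. dind i x u * dind j u y) = (P (\<delta> x y) - a i' * F j (\<delta> x y) - H (\<delta> x y)) / c (Suc i')"
        if x: "x \<in> V" and y: "y \<in> V" for x y
      proof -
        have "(\<Sum>w\<in>V. dind i' x w * (\<Sum>u\<in>V. dind 1 w u * dind j u y)) =
          (\<Sum>w\<in>V. dind i' x w * ((if j = 0 then 0 else b (j - 1) * dind (j - 1) w y)
              + a j * dind j w y + c (j + 1) * dind (j + 1) w y))"
        proof (intro sum.cong refl arg_cong2[where f = "(*)"])
          fix w assume w: "w \<in> V"
          have "(\<Sum>u\<in>V. dind 1 w u * dind j u y) = (\<Sum>u\<in>V. dind j y u * dind 1 u w)"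
            by (rule sum.cong) (use w y dind_sym in \<open>auto simp: mult.commute\<close>)
          also have "\<dots> = (if j = 0 then 0 else b (j - 1) * dind (j - 1) w y)
              + a j * dind j w y + c (j + 1) * dind (j + 1) w y"
            unfolding three_term[OF y w] using dind_sym[OF w y] by simp
          finally show "(\<Sum>u\<in>V. dind 1 w u * dind j u y) = \<dots>" .
        qed
        also have "\<dots> = P (\<delta> x y)"
          unfolding P_def F[OF x y, symmetric]
          by (auto simp: algebra_simps sum.distrib sum_distrib_left)
        finally have "P (\<delta> x y) = (\<Sum>w\<in>V. \<Sum>u\<in>V. dind i' x w * dind 1 w u * dind j u y)"
          by (simp add: sum_distrib_left mult.assoc)
        also have "\<dots> = (\<Sum>u\<in>V. (\<Sum>w\<in>V. dind i' x w * dind 1 w u) * dind j u y)"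
          by (subst sum.swap) (simp add: sum_distrib_right)
        also have "\<dots> = (\<Sum>u\<in>V. ((if i' = 0 then 0 else b (i' - 1) * dind (i' - 1) x u)
            + a i' * dind i' x u + c (i' + 1) * dind (i' + 1) x u) * dind j u y)"
          using three_term[OF x] by (intro sum.cong) auto
        also have "\<dots> = (if i' = 0 then 0 else b (i' - 1) *
            (\<Sum>u\<in>V. dind (i' - 1) x u * dind j u y)) + a i' * (\<Sum>u\<in>V. dind i' x u * dind j u y)
            + c (Suc i') * (\<Sum>u\<in>V. dind i x u * dind j u y)"
          using Suc by (auto simp: algebra_simps sum.distrib sum_distrib_left)
        finally show ?thesis unfolding H[OF x y] F[OF x y] using c by (simp add: field_simps)
      qed
      then show ?thesis
        by (intro exI[of _ "\<lambda>l. (P l - a i' * F j l - H l) / c (Suc i')"]) simp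
    qed
  qed
qed

text \<open>The size of the sphere around \<open>x\<close> is the diagonal entry of
  \<open>A_i A_i\<close> at \<open>x\<close>, which depends only on the distance 0.\<close>

lemma sphere_size: "\<exists>K. \<forall>i. \<forall>x\<in>V. (\<Sum>u\<in>V. dind i x u) = K i"
proof (intro choice allI)
  fix i
  obtain f where f: "\<forall>x\<in>V. \<forall>y\<in>V. (\<Sum>u\<in>V. dind i x u * dind i u y) = f (\<delta> x y)"
    using intersection_numbers by blast
  have "(\<Sum>u\<in>V. dind i x u) = f 0" if x: "x \<in> V" for x
  proof -
    have "(\<Sum>u\<in>V. dind i x u) = (\<Sum>u\<in>V. dind i x u * dind i u x)"
      by (rule sum.cong) (use x dist_sym in \<open>auto simp: dind_def\<close>)
    then show ?thesis using f x dist_0_iff[OF x x] by simp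
  qed
  then show "\<exists>k. \<forall>x\<in>V. (\<Sum>u\<in>V. dind i x u) = k" by blast
qed

text \<open>All edges are pairs at distance 1, so they share one intersection number
  \<open>p\<close>. The factor \<open>dind 1 x y\<close> on both sides lets the equation be used for
  arbitrary pairs under a sum.\<close>

lemma intersection_number_edge:
  "\<exists>p. \<forall>x\<in>V. \<forall>y\<in>V. dind 1 x y * (\<Sum>u\<in>V. dind i u x * dind j u y) = dind 1 x y * p"
proof -
  obtain f where f: "\<forall>x\<in>V. \<forall>y\<in>V. (\<Sum>u\<in>V. dind i x u * dind j u y) = f (\<delta> x y)"
    using intersection_numbers by blast
  have "dind 1 x y * (\<Sum>u\<in>V. dind i u x * dind j u y) = dind 1 x y * f 1"
    if x: "x \<in> V" and y: "y \<in> V" for x y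
  proof -
    have "(\<Sum>u\<in>V. dind i u x * dind j u y) = (\<Sum>u\<in>V. dind i x u * dind j u y)"
      by (rule sum.cong) (use x dind_sym in auto)
    then show ?thesis using f x y by (simp add: dind_def)
  qed
  then show ?thesis by blast
qed

text \<open>
  A pair at distance \<open>i + 1\<close> separated by \<open>S\<close> is split by a middle vertex into a pair at distance
  \<open>i\<close> and an edge, one of which is separated by \<open>S\<close>.
\<close>

lemma separated_pairs_le:
  assumes S: "S \<subseteq> V" and K: "\<forall>i. \<forall>x\<in>V. (\<Sum>u\<in>V. dind i x u) = K i"
  shows "b 0 * (\<Sum>x\<in>S. \<Sum>y\<in>V - S. dind i x y)
    \<le> i * K i * (\<Sum>x\<in>S. \<Sum>y\<in>V - S. dind 1 x y)"
proof (induction i)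
  case 0
  have "dind 0 x y = 0" if "x \<in> S" "y \<in> V - S" for x y
    using that S dist_0_iff[of x y] by (auto simp: dind_def)
  then have "(\<Sum>x\<in>S. \<Sum>y\<in>V - S. dind 0 x y) = 0" by simp
  then show ?case by simp
next
  case (Suc i)
  define E where "E i = (\<Sum>x\<in>S. \<Sum>y\<in>V - S. dind i x y)" for i
  have E_nonneg: "0 \<le> E i" for i by (simp add: E_def sum_nonneg)
  have finV: "finite V" by (rule pair_finite_verts)
  have K_nonneg: "0 \<le> K i" for i using K nonempty by (metis all_not_in_conv dind_nonneg sum_nonneg)
  show ?case
  proof (cases "\<exists>x\<in>V. \<exists>y\<in>V. \<delta> x y = Suc i")
    case False
    then have "dind (Suc i) x y = 0" if "x \<in> S" "y \<in> V - S" for x y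
      using that S by (auto simp: dind_def)
    then have "E (Suc i) = 0" by (simp add: E_def)
    then show ?thesis using E_nonneg[of 1] K_nonneg[of "Suc i"] by (simp add: E_def)
  next
    case True
    then have cpos: "0 < c (Suc i)" using c_pos by blast
    obtain p where p: "\<And>x y. x \<in> V \<Longrightarrow> y \<in> V \<Longrightarrow>
        dind 1 x y * (\<Sum>u\<in>V. dind i u x * dind (Suc i) u y) = dind 1 x y * p"
      using intersection_number_edge by blast
    \<comment> \<open>\<open>T\<close> indicates a geodesic step: \<open>w\<close> is at distance
      \<open>i\<close> from \<open>x\<close>, and its neighbour \<open>y\<close> is at distance
      \<open>i + 1\<close>. Summing out any one of the three vertices leaves a constant times the
      indicator of the remaining pair.\<close>
    define T where "T x w y = dind i x w * dind 1 w y * dind (Suc i) x y" for x w y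
    have T_nonneg: "0 \<le> T x w y" for x w y by (simp add: T_def)
    have sum_w: "(\<Sum>w\<in>V. T x w y) = c (Suc i) * dind (Suc i) x y" if "x \<in> V" "y \<in> V" for x y
    proof -
      have "(\<Sum>w\<in>V. T x w y) = (\<Sum>w\<in>V. dind i x w * dind 1 w y) * dind (Suc i) x y"
        by (simp add: T_def sum_distrib_right)
      then show ?thesis unfolding three_term[OF that] by (auto simp: dind_def)
    qed
    have sum_y: "(\<Sum>y\<in>V. T x w y) = b i * dind i x w" if "x \<in> V" "w \<in> V" for x w
    proof -
      have "(\<Sum>y\<in>V. T x w y) = (\<Sum>y\<in>V. dind (Suc i) x y * dind 1 y w) * dind i x w"
        unfolding T_def sum_distrib_right using that dind_sym by (intro sum.cong) auto
      then show ?thesis unfolding three_term[OF that] by (auto simp: dind_def)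
    qed
    have sum_x: "(\<Sum>x\<in>V. T x w y) = p * dind 1 w y" if "w \<in> V" "y \<in> V" for w y
      using p[OF that] by (simp add: T_def sum_distrib_left mult.commute mult.left_commute)
    have b0: "(\<Sum>y\<in>V. dind 1 w y) = b 0" if "w \<in> V" for w
    proof -
      have "(\<Sum>y\<in>V. dind 1 w y) = (\<Sum>y\<in>V. of_bool ((w, y) \<in> parcs G))"
        using that dist_1_iff by (intro sum.cong) (auto simp: dind_def)
      also have "\<dots> = card (V \<inter> {y. (w, y) \<in> parcs G})"
        using finV by (simp add: of_bool_def sum.If_cases)
      also have "V \<inter> {y. (w, y) \<in> parcs G} = {y. (w, y) \<in> parcs G}" using in_arcsD2 by auto
      finally show ?thesis using valency[OF that] by simp
    qed
    have n: "real (card V) > 0" using nonempty finV by (simp add: card_gt_0_iff)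
    \<comment> \<open>Counting all triples by \<open>(x, y)\<close> and by \<open>(x, w)\<close>
      gives the classical relation between consecutive sphere sizes.\<close>
    have "card V * (c (Suc i) * K (Suc i)) = (\<Sum>x\<in>V. \<Sum>y\<in>V. \<Sum>w\<in>V. T x w y)"
      using K by (simp add: sum_w sum_distrib_left[symmetric])
    also have "\<dots> = (\<Sum>x\<in>V. \<Sum>w\<in>V. \<Sum>y\<in>V. T x w y)"
      by (intro sum.cong refl sum.swap)
    also have "\<dots> = card V * (b i * K i)"
      using K by (simp add: sum_y sum_distrib_left[symmetric])
    finally have bK: "b i * K i = c (Suc i) * K (Suc i)"
      by (metis n mult_left_cancel less_irrefl)
    \<comment> \<open>Grouping the same triples by their edge \<open>(w, y)\<close> evaluates
      \<open>p\<close>.\<close>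
    have "card V * (b i * K i) = (\<Sum>x\<in>V. \<Sum>w\<in>V. \<Sum>y\<in>V. T x w y)"
      using K by (simp add: sum_y sum_distrib_left[symmetric])
    also have "\<dots> = (\<Sum>w\<in>V. \<Sum>x\<in>V. \<Sum>y\<in>V. T x w y)" by (rule sum.swap)
    also have "\<dots> = (\<Sum>w\<in>V. \<Sum>y\<in>V. \<Sum>x\<in>V. T x w y)"
      by (intro sum.cong refl sum.swap)
    also have "\<dots> = card V * (p * b 0)"
      using b0 by (simp add: sum_x sum_distrib_left[symmetric])
    finally have pK: "p * b 0 = c (Suc i) * K (Suc i)" using n bK by (simp del: card_eq_0_iff card_0_eq)
    have split: "V = (V - S) \<union> S" "(V - S) \<inter> S = {}" using S by auto
    have finS: "finite S" using S finV finite_subset by blast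
    \<comment> \<open>Here \<open>x\<close> lies in \<open>S\<close> and \<open>y\<close> does not.
      If \<open>w\<close> is outside \<open>S\<close>, the pair \<open>(x, w)\<close> is separated;
      if \<open>w\<close> is in \<open>S\<close>, the edge \<open>(w, y)\<close> is.\<close>
    have "c (Suc i) * E (Suc i) = (\<Sum>x\<in>S. \<Sum>y\<in>V - S. \<Sum>w\<in>V. T x w y)"
      using S by (auto simp: E_def sum_distrib_left sum_w subset_eq intro!: sum.cong)
    also have "\<dots> = (\<Sum>x\<in>S. \<Sum>y\<in>V - S. \<Sum>w\<in>V - S. T x w y) + (\<Sum>x\<in>S. \<Sum>y\<in>V - S. \<Sum>w\<in>S. T x w y)"
      by (subst split(1), subst sum.union_disjoint)
         (use finV finS in \<open>auto simp: sum.distrib\<close>)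
    also have "(\<Sum>x\<in>S. \<Sum>y\<in>V - S. \<Sum>w\<in>V - S. T x w y) \<le> (\<Sum>x\<in>S. \<Sum>w\<in>V - S. \<Sum>y\<in>V. T x w y)"
    proof (rule sum_mono)
      fix x
      have "(\<Sum>y\<in>V - S. \<Sum>w\<in>V - S. T x w y) = (\<Sum>w\<in>V - S. \<Sum>y\<in>V - S. T x w y)" by (rule sum.swap)
      also have "\<dots> \<le> (\<Sum>w\<in>V - S. \<Sum>y\<in>V. T x w y)"
        by (intro sum_mono sum_mono2) (use finV T_nonneg in auto)
      finally show "(\<Sum>y\<in>V - S. \<Sum>w\<in>V - S. T x w y) \<le> (\<Sum>w\<in>V - S. \<Sum>y\<in>V. T x w y)" .
    qed
    also have "\<dots> = b i * E i"
      using S by (auto simp: E_def sum_distrib_left sum_y subset_eq intro!: sum.cong)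
    also have "(\<Sum>x\<in>S. \<Sum>y\<in>V - S. \<Sum>w\<in>S. T x w y) = (\<Sum>x\<in>S. \<Sum>w\<in>S. \<Sum>y\<in>V - S. T x w y)"
      by (intro sum.cong refl sum.swap)
    also have "\<dots> = (\<Sum>w\<in>S. \<Sum>x\<in>S. \<Sum>y\<in>V - S. T x w y)" by (rule sum.swap)
    also have "\<dots> = (\<Sum>w\<in>S. \<Sum>y\<in>V - S. \<Sum>x\<in>S. T x w y)"
      by (intro sum.cong refl sum.swap)
    also have "\<dots> \<le> (\<Sum>w\<in>S. \<Sum>y\<in>V - S. \<Sum>x\<in>V. T x w y)"
      by (intro sum_mono sum_mono2) (use finV S T_nonneg in auto)
    also have "\<dots> = p * E 1"
      using S by (auto simp: E_def sum_distrib_left sum_x subset_eq intro!: sum.cong)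
    finally have "c (Suc i) * E (Suc i) \<le> b i * E i + p * E 1" by simp
    \<comment> \<open>After the induction hypothesis both terms are multiples of
      \<open>c (Suc i) * K (Suc i) * E 1\<close>, with coefficients \<open>i\<close> and 1.\<close>
    then have "b 0 * (c (Suc i) * E (Suc i)) \<le> b 0 * (b i * E i + p * E 1)"
      by (intro mult_left_mono) auto
    also have "\<dots> = b i * (b 0 * E i) + (p * b 0) * E 1" by (simp add: algebra_simps)
    also have "\<dots> \<le> b i * (i * K i * E 1) + (p * b 0) * E 1"
      using Suc.IH by (intro add_right_mono mult_left_mono) (auto simp: E_def)
    also have "\<dots> = i * (b i * K i) * E 1 + (p * b 0) * E 1" by (simp add: algebra_simps)
    also have "\<dots> = c (Suc i) * (Suc i * K (Suc i) * E 1)"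
      unfolding bK pK by (simp add: algebra_simps)
    finally have "c (Suc i) * (b 0 * E (Suc i)) \<le> c (Suc i) * (Suc i * K (Suc i) * E 1)"
      by (simp add: algebra_simps)
    then have "b 0 * E (Suc i) \<le> Suc i * K (Suc i) * E 1"
      using cpos by (simp add: mult_le_cancel_left_pos)
    then show ?thesis by (simp add: E_def)
  qed
qed

text \<open>Sum the bound on separated pairs over all \<open>i \<le> d\<close>, estimating the
  factor \<open>i\<close> by \<open>d\<close>. Each pair in \<open>S \<times> (V - S)\<close> has
  exactly one distance, so the left sides add up to all such pairs, and the sphere sizes add up to
  \<open>card V\<close>.\<close>

theorem edge_isoperimetry:
  assumes S: "S \<subseteq> V"
  shows "b 0 * card S * card (V - S)
    \<le> d * card V * (\<Sum>x\<in>S. card {y \<in> V - S. (x, y) \<in> parcs G})"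
proof -
  obtain K where K: "\<forall>i. \<forall>x\<in>V. (\<Sum>u\<in>V. dind i x u) = K i" using sphere_size by blast
  define E where "E i = (\<Sum>x\<in>S. \<Sum>y\<in>V - S. dind i x y)" for i
  have finV: "finite V" by (rule pair_finite_verts)
  have one: "(\<Sum>i\<le>d. dind i x y) = 1" if "x \<in> V" "y \<in> V" for x y
    using dist_le_diameter[OF that] by (simp add: dind_def of_bool_def)
  have E_nonneg: "0 \<le> E i" for i by (simp add: E_def sum_nonneg)
  have K_nonneg: "0 \<le> K i" for i using K nonempty by (metis all_not_in_conv dind_nonneg sum_nonneg)
  obtain z where z: "z \<in> V" using nonempty by blast
  have "(\<Sum>i\<le>d. E i) = (\<Sum>x\<in>S. \<Sum>i\<le>d. \<Sum>y\<in>V - S. dind i x y)"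
    unfolding E_def by (rule sum.swap)
  also have "\<dots> = (\<Sum>x\<in>S. \<Sum>y\<in>V - S. \<Sum>i\<le>d. dind i x y)"
    by (intro sum.cong refl sum.swap)
  also have "\<dots> = (\<Sum>x\<in>S. \<Sum>y\<in>V - S. 1)"
    using S one by (intro sum.cong) auto
  finally have sumE: "(\<Sum>i\<le>d. E i) = card S * card (V - S)" by simp
  have "(\<Sum>i\<le>d. K i) = (\<Sum>i\<le>d. \<Sum>u\<in>V. dind i z u)" using K z by simp
  also have "\<dots> = (\<Sum>u\<in>V. \<Sum>i\<le>d. dind i z u)" by (rule sum.swap)
  finally have sumK: "(\<Sum>i\<le>d. K i) = card V" using one z by simp
  have "b 0 * (\<Sum>i\<le>d. E i) = (\<Sum>i\<le>d. b 0 * E i)" by (rule sum_distrib_left)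
  also have "\<dots> \<le> (\<Sum>i\<le>d. i * K i * E 1)"
    using separated_pairs_le[OF S K] by (intro sum_mono) (simp add: E_def)
  also have "\<dots> \<le> (\<Sum>i\<le>d. d * K i * E 1)"
    using E_nonneg K_nonneg by (intro sum_mono mult_right_mono) auto
  also have "\<dots> = d * (\<Sum>i\<le>d. K i) * E 1" by (simp add: sum_distrib_left sum_distrib_right)
  finally have main: "b 0 * (card S * card (V - S)) \<le> real d * card V * E 1"
    unfolding sumE sumK by simp
  have "E 1 = (\<Sum>x\<in>S. card {y \<in> V - S. (x, y) \<in> parcs G})"
    unfolding E_def of_nat_sum
  proof (rule sum.cong)
    fix x assume x: "x \<in> S"
    have "(\<Sum>y\<in>V - S. dind 1 x y) = (\<Sum>y\<in>V - S. of_bool ((x, y) \<in> parcs G))"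
      using x S dist_1_iff by (intro sum.cong) (auto simp: dind_def)
    also have "\<dots> = card ((V - S) \<inter> {y. (x, y) \<in> parcs G})"
      using finV by (simp add: of_bool_def sum.If_cases)
    also have "(V - S) \<inter> {y. (x, y) \<in> parcs G} = {y \<in> V - S. (x, y) \<in> parcs G}" by auto
    finally show "(\<Sum>y\<in>V - S. dind 1 x y) = card {y \<in> V - S. (x, y) \<in> parcs G}" .
  qed simp
  with main have "real (b 0 * card S * card (V - S))
    \<le> real (d * card V * (\<Sum>x\<in>S. card {y \<in> V - S. (x, y) \<in> parcs G}))"
    by (simp add: mult.assoc)
  then show ?thesis by (simp only: of_nat_le_iff)
qed

end

subsection \<open>Automorphisms of distance-regular graphs with \<open>\<mu> = 1\<close>\<close>

locale drg_mu1 = drg +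
  assumes diam: "2 \<le> d" and mu: "c 2 = 1"
begin

text \<open>Distinct nonadjacent vertices with a common neighbour are at distance 2, where
  \<open>c 2 = 1\<close> counts the common neighbours.\<close>

lemma common_neighbour_unique:
  assumes xy: "x \<noteq> y" "(x, y) \<notin> parcs G"
    and u: "(x, u) \<in> parcs G" "(y, u) \<in> parcs G"
    and v: "(x, v) \<in> parcs G" "(y, v) \<in> parcs G"
  shows "u = v"
proof -
  have V: "x \<in> V" "y \<in> V" "u \<in> V" "v \<in> V" using u v in_arcsD1 in_arcsD2 by blast+
  have "\<delta> x u = 1" "\<delta> x v = 1" using u v V dist_1_iff by auto
  moreover from this have "\<delta> x y \<le> 2"
    using dist_step[of x u y] V u parcs_sym by fastforce
  moreover have "\<delta> x y \<noteq> 0" "\<delta> x y \<noteq> Suc 0" using dist_0_iff dist_1_iff V xy by auto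
  ultimately have 2: "\<delta> x y = 2" "u \<in> {u. (y, u) \<in> parcs G \<and> \<delta> x u + 1 = 2}"
    "v \<in> {u. (y, u) \<in> parcs G \<and> \<delta> x u + 1 = 2}" using u v by auto
  have "card {u. (y, u) \<in> parcs G \<and> \<delta> x u + 1 = 2} = 1"
    using card_c[OF V(1,2)] 2(1) mu by simp
  then show ?thesis using 2 by (metis card_1_singletonE singletonD)
qed

text \<open>Otherwise \<open>u\<close> and \<open>v\<close> would be two common neighbours of a
  nonadjacent pair. Consequently "adjacent or equal" is an equivalence relation on each
  neighbourhood.\<close>

lemma diamond_free:
  assumes "(u, v) \<in> parcs G" "(x, u) \<in> parcs G" "(x, v) \<in> parcs G"
    "(y, u) \<in> parcs G" "(y, v) \<in> parcs G"
  shows "x = y \<or> (x, y) \<in> parcs G"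
  using assms common_neighbour_unique[of x y u v] parcs_neq by blast

text \<open>For adjacent \<open>w\<close> and \<open>v\<close> this is the equivalence class of
  \<open>v\<close> in the neighbourhood of \<open>w\<close>; adding \<open>w\<close> gives the
  maximal clique through the edge.\<close>

definition block :: "'a \<Rightarrow> 'a \<Rightarrow> 'a set" where
  "block w v = {u. (w, u) \<in> parcs G \<and> (u = v \<or> (u, v) \<in> parcs G)}"

lemma finite_neighbours: "finite {u. (w, u) \<in> parcs G}"
  by (rule finite_subset[OF _ pair_finite_verts]) (use in_arcsD2 in auto)

text \<open>The block consists of \<open>v\<close> and the \<open>a 1\<close> common neighbours of
  \<open>w\<close> and \<open>v\<close>.\<close>

lemma card_block:
  assumes "(w, v) \<in> parcs G"
  shows "card (block w v) = Suc (a 1)"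
proof -
  have V: "w \<in> V" "v \<in> V" using assms in_arcsD1 in_arcsD2 by auto
  have d: "\<delta> w v = 1" using dist_1_iff V assms by simp
  let ?C = "{u. (v, u) \<in> parcs G \<and> \<delta> w u = 1}"
  have "block w v = insert v ?C"
    unfolding block_def using V assms dist_1_iff parcs_sym in_arcsD2 by auto
  moreover have "finite ?C" by (rule finite_subset[OF _ finite_neighbours[of v]]) auto
  moreover have "v \<notin> ?C" using parcs_neq by auto
  ultimately show ?thesis using card_a[OF V] d by simp
qed

text \<open>Pairwise nonadjacent neighbours of \<open>w\<close> have disjoint blocks, all inside a
  neighbourhood of size \<open>b 0\<close>.\<close>

lemma independent_neighbours_bound:
  assumes T: "T \<subseteq> {u. (w, u) \<in> parcs G}" and w: "w \<in> V"
    and indep: "\<And>u v. u \<in> T \<Longrightarrow> v \<in> T \<Longrightarrow> (u, v) \<notin> parcs G"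
  shows "card T * Suc (a 1) \<le> b 0"
proof -
  have finT: "finite T" using T finite_neighbours finite_subset by blast
  have "block w u \<inter> block w v = {}" if uv: "u \<in> T" "v \<in> T" "u \<noteq> v" for u v
  proof (rule ccontr)
    assume "block w u \<inter> block w v \<noteq> {}"
    then obtain z where z: "(w, z) \<in> parcs G" "z = u \<or> (z, u) \<in> parcs G" "z = v \<or> (z, v) \<in> parcs G"
      unfolding block_def by auto
    show False
    proof (cases "z = u \<or> z = v")
      case True
      then show ?thesis using z uv indep by blast
    next
      case False
      then have "u = v \<or> (u, v) \<in> parcs G"
        using z T uv parcs_sym by (intro diamond_free[of w z]) auto
      then show ?thesis using uv indep by blast
    qed
  qed
  then have "card (\<Union>v\<in>T. block w v) = (\<Sum>v\<in>T. card (block w v))"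
    using finT finite_subset[OF _ finite_neighbours[of w]]
    by (intro card_UN_disjoint) (auto simp: block_def)
  also have "\<dots> = card T * Suc (a 1)" using T card_block by (simp add: subset_eq)
  finally have "card T * Suc (a 1) = card (\<Union>v\<in>T. block w v)" by simp
  also have "\<dots> \<le> card {u. (w, u) \<in> parcs G}"
    using finite_neighbours by (intro card_mono) (auto simp: block_def)
  finally show ?thesis using valency[OF w] by simp
qed

text \<open>The ends of a geodesic of length 2 are nonadjacent neighbours of its middle
  vertex.\<close>

lemma valency_ge_two_blocks: "2 * Suc (a 1) \<le> b 0"
proof -
  obtain x z where xz: "x \<in> V" "z \<in> V" "\<delta> x z = 2" using dist_attained[OF diam] .
  obtain y where y: "(y, z) \<in> parcs G" "\<delta> x y = 1"
    using dist_pred[of x z 1] xz by (auto simp: numeral_2_eq_2)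
  have V: "y \<in> V" using y in_arcsD1 by blast
  have n: "x \<noteq> z" "(x, z) \<notin> parcs G" using xz dist_0_iff[of x z] dist_1_iff[of x z] by auto
  have "(x, y) \<in> parcs G" using y V xz dist_1_iff by simp
  then have "card {x, z} * Suc (a 1) \<le> b 0"
    using n y V parcs_sym parcs_neq by (intro independent_neighbours_bound[of _ y]) auto
  then show ?thesis using n by simp
qed

end

section \<open>Moved and fixed vertices of an automorphism\<close>

locale drg_mu1_aut = drg_mu1 +
  fixes \<sigma> :: "'a \<Rightarrow> 'a"
  assumes aut: "\<sigma> \<in> graph_automorphisms G"
begin

definition moved :: "'a set" where
  "moved = {v \<in> V. \<sigma> v \<noteq> v}"

text \<open>Only these moved vertices can have more than one fixed neighbour: any other moved vertex
  with a fixed neighbour is nonadjacent to its image.\<close>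

definition shifted :: "'a set" where
  "shifted = {v \<in> moved. (v, \<sigma> v) \<in> parcs G \<and> (\<exists>f\<in>V - moved. (v, f) \<in> parcs G)}"

lemma arc_image: "(u, v) \<in> parcs G \<Longrightarrow> (\<sigma> u, \<sigma> v) \<in> parcs G"
  using aut in_arcsD1 in_arcsD2 unfolding graph_automorphisms_def by blast

lemma arc_image_iff: "u \<in> V \<Longrightarrow> v \<in> V \<Longrightarrow> (\<sigma> u, \<sigma> v) \<in> parcs G \<longleftrightarrow> (u, v) \<in> parcs G"
  using aut unfolding graph_automorphisms_def by blast

lemma fixed_iff: "f \<in> V - moved \<longleftrightarrow> f \<in> V \<and> \<sigma> f = f"
  by (auto simp: moved_def)

lemma arc_fixed: "f \<in> V - moved \<Longrightarrow> (v, f) \<in> parcs G \<Longrightarrow> (\<sigma> v, f) \<in> parcs G"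
  using arc_image[of v f] fixed_iff by simp

text \<open>A shifted \<open>v\<close> has all its neighbours outside
  \<open>block v (\<sigma> v)\<close> in \<open>moved - shifted\<close>. This is the lower bound for
  the double count of edges between shifted and other moved vertices.\<close>

lemma shifted_neighbour_outside_block:
  assumes v: "v \<in> shifted" and w: "(v, w) \<in> parcs G" "w \<noteq> \<sigma> v" "(w, \<sigma> v) \<notin> parcs G"
  shows "w \<in> moved - shifted"
proof -
  obtain f where f: "f \<in> V - moved" "(v, f) \<in> parcs G" using v by (auto simp: shifted_def)
  have vs: "(v, \<sigma> v) \<in> parcs G" "v \<in> moved" using v by (auto simp: shifted_def)
  have V: "v \<in> V" "w \<in> V" using w in_arcsD1 in_arcsD2 by auto
  have sw: "(\<sigma> v, \<sigma> w) \<in> parcs G" using arc_image w by blast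
  have "\<sigma> w \<noteq> w" using sw w parcs_sym by metis
  moreover have "(w, \<sigma> w) \<notin> parcs G"
  proof
    assume a: "(w, \<sigma> w) \<in> parcs G"
    \<comment> \<open>Both \<open>v\<close> and \<open>\<sigma> w\<close> are common neighbours of
      the nonadjacent pair \<open>w\<close>, \<open>\<sigma> v\<close>. Now
      \<open>\<sigma> w = v\<close> is adjacent to the fixed \<open>f\<close>, hence so is
      \<open>w\<close>, and \<open>f\<close> becomes a second common neighbour of that pair.\<close>
    have "v = \<sigma> w"
      using common_neighbour_unique[of w "\<sigma> v" v "\<sigma> w"] w vs a sw parcs_sym by blast
    then have "(w, f) \<in> parcs G" using arc_image_iff[of w f] f V fixed_iff by simp
    then have "v = f"
      using common_neighbour_unique[of w "\<sigma> v" v f] w vs parcs_sym arc_fixed f by blast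
    then show False using f vs by blast
  qed
  ultimately show ?thesis using V by (auto simp: moved_def shifted_def)
qed

text \<open>Conversely, moved vertices inside \<open>block v (\<sigma> v)\<close> are shifted: such
  a \<open>w\<close> is adjacent to the fixed neighbour \<open>f\<close> of \<open>v\<close>, and
  \<open>w\<close> and \<open>\<sigma> w\<close> turn out to be adjacent.\<close>

lemma block_of_shifted:
  assumes v: "v \<in> shifted" and w: "w \<in> moved - shifted" "(w, v) \<in> parcs G"
  shows "w \<noteq> \<sigma> v" and "(w, \<sigma> v) \<notin> parcs G"
proof -
  obtain f where f: "f \<in> V - moved" "(v, f) \<in> parcs G" using v by (auto simp: shifted_def)
  have vs: "(v, \<sigma> v) \<in> parcs G" "v \<in> moved" using v by (auto simp: shifted_def)
  have fs: "(\<sigma> v, f) \<in> parcs G" using arc_fixed f by blast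
  show "w \<noteq> \<sigma> v"
  proof
    assume "w = \<sigma> v"
    then show False using w f fs arc_image[OF vs(1)] by (auto simp: shifted_def)
  qed
  show "(w, \<sigma> v) \<notin> parcs G"
  proof
    assume a: "(w, \<sigma> v) \<in> parcs G"
    have "w \<noteq> f" using w f by auto
    then have wf: "(w, f) \<in> parcs G"
      using diamond_free[of v "\<sigma> v" w f] vs w a f fs parcs_sym by blast
    have "w = \<sigma> w \<or> (w, \<sigma> w) \<in> parcs G"
      using diamond_free[of f "\<sigma> v" w "\<sigma> w"] fs wf a arc_fixed f(1) w arc_image[of w v] parcs_sym
      by blast
    then show False using w wf f by (auto simp: moved_def shifted_def)
  qed
qed

text \<open>If \<open>u\<close> and \<open>v\<close> were adjacent, \<open>v\<close> would lie in
  \<open>block u (\<sigma> u)\<close>, because it is shifted. Then \<open>w\<close>, adjacent to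
  both \<open>u\<close> and \<open>v\<close>, would lie in this block too, although it is not
  shifted.\<close>

lemma shifted_neighbours_independent:
  assumes w: "w \<in> moved - shifted"
    and u: "u \<in> shifted" "(w, u) \<in> parcs G" and v: "v \<in> shifted" "(w, v) \<in> parcs G"
  shows "(u, v) \<notin> parcs G"
proof
  assume uv: "(u, v) \<in> parcs G"
  have us: "(u, \<sigma> u) \<in> parcs G" using u by (auto simp: shifted_def)
  note nb = block_of_shifted[OF u(1) w u(2)]
  have "v = \<sigma> u \<or> (v, \<sigma> u) \<in> parcs G"
    using shifted_neighbour_outside_block[OF u(1) uv] v by blast
  then show False
  proof
    assume "v = \<sigma> u"
    then show False using v nb by blast
  next
    assume "(v, \<sigma> u) \<in> parcs G"
    then have "w = \<sigma> u \<or> (w, \<sigma> u) \<in> parcs G"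
      using diamond_free[of u v w "\<sigma> u"] uv u v us parcs_sym by blast
    then show False using nb by blast
  qed
qed

lemma finite_moved: "finite moved"
  unfolding moved_def using pair_finite_verts by simp

text \<open>Count the edges between \<open>shifted\<close> and \<open>moved - shifted\<close>. With
  \<open>k = b 0\<close> and \<open>s = Suc (a 1)\<close>, each shifted vertex has at least
  \<open>k - s\<close> of them and each other moved vertex at most \<open>k / s\<close>.\<close>

lemma card_shifted: "card shifted * Suc (a 1) \<le> 2 * card (moved - shifted)"
proof -
  let ?s = "Suc (a 1)" and ?k = "b 0" and ?A = shifted and ?B = "moved - shifted"
  have fin: "finite ?A" "finite ?B"
    using finite_moved finite_subset[of shifted moved] by (auto simp: shifted_def)
  have "card ?A * (?k - ?s) = (\<Sum>v\<in>?A. ?k - ?s)" by simp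
  also have "\<dots> \<le> (\<Sum>v\<in>?A. card {w \<in> ?B. (v, w) \<in> parcs G})"
  proof (rule sum_mono)
    fix v assume v: "v \<in> ?A"
    then have V: "v \<in> V" "(v, \<sigma> v) \<in> parcs G" by (auto simp: shifted_def moved_def)
    have "?k - ?s = card ({w. (v, w) \<in> parcs G} - block v (\<sigma> v))"
      using valency[OF V(1)] card_block[OF V(2)] finite_subset[OF _ finite_neighbours[of v]]
      by (subst card_Diff_subset) (auto simp: block_def)
    also have "\<dots> \<le> card {w \<in> ?B. (v, w) \<in> parcs G}"
      using shifted_neighbour_outside_block[OF v] fin
      by (intro card_mono) (auto simp: block_def)
    finally show "?k - ?s \<le> card {w \<in> ?B. (v, w) \<in> parcs G}" .
  qed
  also have "\<dots> = (\<Sum>w\<in>?B. card {v \<in> ?A. (w, v) \<in> parcs G})"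
  proof -
    have "{v \<in> ?A. (w, v) \<in> parcs G} = {v \<in> ?A. (v, w) \<in> parcs G}" for w
      using parcs_sym by blast
    then show ?thesis using sum.swap_restrict[OF fin, of "\<lambda>_ _. 1::nat" "\<lambda>v w. (v, w) \<in> parcs G"]
      by simp
  qed
  finally have "card ?A * (?k - ?s) * ?s \<le> (\<Sum>w\<in>?B. card {v \<in> ?A. (w, v) \<in> parcs G}) * ?s"
    by (rule mult_right_mono) simp
  also have "\<dots> = (\<Sum>w\<in>?B. card {v \<in> ?A. (w, v) \<in> parcs G} * ?s)" by (rule sum_distrib_right)
  also have "\<dots> \<le> (\<Sum>w\<in>?B. ?k)"
  proof (rule sum_mono)
    fix w assume w: "w \<in> ?B"
    then have "w \<in> V" by (simp add: moved_def)
    then show "card {v \<in> ?A. (w, v) \<in> parcs G} * ?s \<le> ?k"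
      using shifted_neighbours_independent[OF w] by (intro independent_neighbours_bound) auto
  qed
  finally have le: "card ?A * (?k - ?s) * ?s \<le> card ?B * ?k" by simp
  \<comment> \<open>At least half of a neighbourhood lies outside a given block, so replacing
    \<open>k - s\<close> by \<open>k\<close> costs a factor of 2.\<close>
  have "?k \<le> 2 * (?k - ?s)" using valency_ge_two_blocks by simp
  then have "card ?A * ?s * ?k \<le> card ?A * ?s * (2 * (?k - ?s))" by (rule mult_left_mono) simp
  also have "\<dots> = 2 * (card ?A * (?k - ?s) * ?s)" by (simp only: ac_simps)
  also have "\<dots> \<le> 2 * (card ?B * ?k)" using le by (rule mult_left_mono) simp
  finally have "card ?A * ?s * ?k \<le> 2 * card ?B * ?k" by (simp only: ac_simps)
  moreover have "0 < ?k" using valency_ge_two_blocks by simp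
  ultimately show ?thesis by (simp only: mult_le_cancel2)
qed

text \<open>Fixed neighbours of a shifted \<open>v\<close> lie in
  \<open>block v (\<sigma> v)\<close>, and any other moved vertex has at most one. By
  \<open>card_shifted\<close> the first kind contributes at most twice the number of vertices of the
  second kind.\<close>

lemma moved_boundary_le:
  "(\<Sum>v\<in>moved. card {f \<in> V - moved. (v, f) \<in> parcs G}) \<le> 3 * card moved"
proof -
  have fin: "finite shifted" "finite (moved - shifted)"
    using finite_moved finite_subset[of shifted moved] by (auto simp: shifted_def)
  have split: "moved = shifted \<union> (moved - shifted)" by (auto simp: shifted_def)
  have "(\<Sum>v\<in>moved. card {f \<in> V - moved. (v, f) \<in> parcs G})
      = (\<Sum>v\<in>shifted. card {f \<in> V - moved. (v, f) \<in> parcs G})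
      + (\<Sum>v\<in>moved - shifted. card {f \<in> V - moved. (v, f) \<in> parcs G})"
    using fin by (subst (1) split, subst sum.union_disjoint) auto
  also have "\<dots> \<le> (\<Sum>v\<in>shifted. Suc (a 1)) + (\<Sum>v\<in>moved - shifted. 1)"
  proof (intro add_mono sum_mono)
    fix v assume v: "v \<in> shifted"
    then have vs: "(v, \<sigma> v) \<in> parcs G" by (auto simp: shifted_def)
    have "card {f \<in> V - moved. (v, f) \<in> parcs G} \<le> card (block v (\<sigma> v))"
      using arc_fixed parcs_sym finite_subset[OF _ finite_neighbours[of v]]
      by (intro card_mono) (auto simp: block_def)
    then show "card {f \<in> V - moved. (v, f) \<in> parcs G} \<le> Suc (a 1)"
      using card_block[OF vs] by simp
  next
    fix v assume v: "v \<in> moved - shifted"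
    let ?F = "{f \<in> V - moved. (v, f) \<in> parcs G}"
    have "finite ?F" by (rule finite_subset[OF _ finite_neighbours[of v]]) auto
    \<comment> \<open>A fixed neighbour of an unshifted \<open>v\<close> forces \<open>v\<close> and
      \<open>\<sigma> v\<close> to be nonadjacent, and \<open>f\<close> and \<open>g\<close> are
      common neighbours of these two.\<close>
    moreover have "f = g" if "f \<in> ?F" "g \<in> ?F" for f g
      using common_neighbour_unique[of v "\<sigma> v" f g] that v arc_fixed
      by (auto simp: shifted_def moved_def)
    ultimately show "card ?F \<le> 1" by (auto simp: card_le_Suc0_iff_eq)
  qed
  also have "\<dots> = card shifted * Suc (a 1) + card (moved - shifted)" by simp
  also have "\<dots> \<le> 3 * card (moved - shifted)" using card_shifted by simp
  also have "\<dots> \<le> 3 * card moved" using finite_moved by (simp add: card_mono)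
  finally show ?thesis .
qed

text \<open>Comparing the isoperimetric lower bound on the boundary of \<open>moved\<close> with the
  upper bound 3 per moved vertex leaves \<open>2 * card (V - moved) \<le> card V\<close>.\<close>

theorem half_moved:
  assumes k: "6 * d \<le> b 0" and ne: "moved \<noteq> {}"
  shows "card V \<le> 2 * card moved"
proof -
  have sub: "moved \<subseteq> V" by (auto simp: moved_def)
  have pos: "0 < card moved" "0 < d" using ne finite_moved diam by (auto simp: card_gt_0_iff)
  have "6 * d * card moved * card (V - moved) \<le> b 0 * card moved * card (V - moved)"
    using k by (intro mult_right_mono) auto
  also have "\<dots> \<le> d * card V * (\<Sum>v\<in>moved. card {f \<in> V - moved. (v, f) \<in> parcs G})"
    by (rule edge_isoperimetry[OF sub])
  also have "\<dots> \<le> d * card V * (3 * card moved)"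
    using moved_boundary_le by (rule mult_left_mono) simp
  finally have "(3 * d * card moved) * (2 * card (V - moved)) \<le> (3 * d * card moved) * card V"
    by (simp add: ac_simps)
  then have "2 * card (V - moved) \<le> card V" using pos by (simp only: mult_le_cancel1) simp
  moreover have "card (V - moved) = card V - card moved"
    using sub finite_moved by (simp add: card_Diff_subset)
  ultimately show ?thesis by simp
qed

end

subsection \<open>Hamming graphs\<close>

lemma vertex_enum:
  assumes "finite (pverts G)"
  shows "distinct (vertex_enum G)" "set (vertex_enum G) = pverts G"
    "length (vertex_enum G) = card (pverts G)"
proof -
  have "\<exists>vs. distinct vs \<and> set vs = pverts G"
    using finite_distinct_list[OF assms] by blast
  from someI_ex[OF this] show *: "distinct (vertex_enum G)" "set (vertex_enum G) = pverts G"
    unfolding vertex_enum_def by auto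
  show "length (vertex_enum G) = card (pverts G)" using distinct_card[OF *(1)] *(2) by simp
qed

text \<open>An eigenfunction on the vertices becomes an eigenvector by reading it along the chosen
  enumeration.\<close>

lemma eigenvalue_adj_matrixI:
  fixes g :: "'a \<Rightarrow> real"
  assumes fin: "finite (pverts G)" and x: "x \<in> pverts G" "g x \<noteq> 0"
    and eig: "\<And>x. x \<in> pverts G \<Longrightarrow> (\<Sum>y\<in>{y \<in> pverts G. (x, y) \<in> parcs G}. g y) = \<theta> * g x"
  shows "eigenvalue (adj_matrix G) \<theta>"
proof -
  let ?n = "card (pverts G)"
  note vs = vertex_enum[OF fin]
  define v where "v = vec ?n (\<lambda>i. g (vertex_enum G ! i))"
  have bij: "bij_betw ((!) (vertex_enum G)) {..<?n} (pverts G)"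
    by (rule bij_betw_nth) (use vs in auto)
  have dim: "dim_row (adj_matrix G) = ?n" by (simp add: adj_matrix_def)
  obtain i where i: "i < ?n" "vertex_enum G ! i = x"
    using x(1) vs by (metis in_set_conv_nth)
  then have "v $ i \<noteq> 0\<^sub>v ?n $ i" using x by (simp add: v_def)
  then have "v \<noteq> 0\<^sub>v ?n" by auto
  moreover have "adj_matrix G *\<^sub>v v = \<theta> \<cdot>\<^sub>v v"
  proof (rule eq_vecI)
    fix i assume "i < dim_vec (\<theta> \<cdot>\<^sub>v v)"
    then have i: "i < ?n" by (simp add: v_def)
    let ?x = "vertex_enum G ! i"
    have xV: "?x \<in> pverts G" using i vs nth_mem by metis
    have "(adj_matrix G *\<^sub>v v) $ i = (\<Sum>j<?n. (if (?x, vertex_enum G ! j) \<in> parcs G then 1 else 0)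
        * g (vertex_enum G ! j))"
      using i by (simp add: adj_matrix_def v_def scalar_prod_def lessThan_atLeast0)
    also have "\<dots> = (\<Sum>y\<in>pverts G. (if (?x, y) \<in> parcs G then 1 else 0) * g y)"
      by (rule sum.reindex_bij_betw[OF bij])
    also have "\<dots> = (\<Sum>y\<in>pverts G. if (?x, y) \<in> parcs G then g y else 0)"
      by (intro sum.cong) auto
    also have "\<dots> = (\<Sum>y\<in>{y \<in> pverts G. (?x, y) \<in> parcs G}. g y)"
      using fin by (simp add: sum.inter_filter)
    finally show "(adj_matrix G *\<^sub>v v) $ i = (\<theta> \<cdot>\<^sub>v v) $ i"
      using eig[OF xV] i by (simp add: v_def)
  qed (simp add: dim v_def)
  ultimately show ?thesis
    unfolding eigenvalue_def eigenvector_def dim by (intro exI[of _ v]) (simp add: v_def)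
qed

text \<open>An eigenvalue below another one is not at position 0 of the non-increasing list, so it
  takes part in the maximum.\<close>

lemma abs_le_zero_weight_spectral_radius:
  assumes "eigenvalue (adj_matrix G) \<theta>" "eigenvalue (adj_matrix G) \<kappa>" "\<theta> < \<kappa>"
  shows "\<bar>\<theta>\<bar> \<le> zero_weight_spectral_radius G"
proof -
  let ?L = "graph_eigenvalues G"
  have A: "adj_matrix G \<in> carrier_mat (card (pverts G)) (card (pverts G))"
    by (simp add: adj_matrix_def)
  have nz: "char_poly (adj_matrix G) \<noteq> 0"
    using degree_monic_char_poly[OF A] by (metis coeff_0 zero_neq_one)
  have set: "set ?L = {x. eigenvalue (adj_matrix G) x}"
    using nz by (simp add: graph_eigenvalues_def eigenvalue_root_char_poly[OF A] set_count_proots)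
  have sorted: "sorted (rev ?L)" by (simp add: graph_eigenvalues_def)
  obtain i where i: "i < length ?L" "?L ! i = \<theta>"
    using assms(1) set by (metis in_set_conv_nth mem_Collect_eq)
  obtain j where j: "j < length ?L" "?L ! j = \<kappa>"
    using assms(2) set by (metis in_set_conv_nth mem_Collect_eq)
  have "i \<noteq> 0"
  proof
    assume "i = 0"
    then have "?L ! j \<le> ?L ! i" using sorted_rev_nth_mono[OF sorted, of i j] j by simp
    then show False using i j assms(3) by simp
  qed
  then have "\<bar>\<theta>\<bar> \<in> {\<bar>?L ! i\<bar> |i. 1 \<le> i \<and> i < length ?L}"
    using i by force
  then show ?thesis
    unfolding zero_weight_spectral_radius_def by (intro Max_ge) auto
qed

section \<open>Words and Hamming distance\<close>

definition words :: "nat \<Rightarrow> nat \<Rightarrow> (nat \<Rightarrow> nat) set" where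
  "words d q = (\<Pi>\<^sub>E i\<in>{..<d}. {..<q})"

definition hamming :: "nat \<Rightarrow> (nat \<Rightarrow> nat) \<Rightarrow> (nat \<Rightarrow> nat) \<Rightarrow> nat" where
  "hamming d x y = card {i. i < d \<and> x i \<noteq> y i}"

lemma words_less: "x \<in> words d q \<Longrightarrow> i < d \<Longrightarrow> x i < q"
  by (auto simp: words_def)

lemma words_update: "x \<in> words d q \<Longrightarrow> i < d \<Longrightarrow> t < q \<Longrightarrow> x(i := t) \<in> words d q"
  by (auto simp: words_def PiE_iff extensional_def)

lemma words_eqI: "x \<in> words d q \<Longrightarrow> y \<in> words d q \<Longrightarrow> (\<And>i. i < d \<Longrightarrow> x i = y i) \<Longrightarrow> x = y"
  unfolding words_def by (rule PiE_ext) auto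

lemma hamming_sym: "hamming d x y = hamming d y x"
  unfolding hamming_def by (rule arg_cong[where f = card]) auto

lemma hamming_0_iff:
  "x \<in> words d q \<Longrightarrow> y \<in> words d q \<Longrightarrow> hamming d x y = 0 \<longleftrightarrow> x = y"
  unfolding hamming_def using words_eqI[of x d q y] by auto

lemma hamming_le: "hamming d x y \<le> d"
  unfolding hamming_def using card_mono[of "{..<d}" "{i. i < d \<and> x i \<noteq> y i}"] by auto

text \<open>Changing one letter destroys an agreement with \<open>y\<close>, creates one, or leaves
  a disagreement; these cases yield \<open>b\<close>, \<open>c\<close> and \<open>a\<close>
  respectively.\<close>

lemma hamming_update:
  assumes i: "i < d" and t: "t \<noteq> x i"
  shows "y i = x i \<Longrightarrow> hamming d y (x(i := t)) = Suc (hamming d y x)"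
    and "y i \<noteq> x i \<Longrightarrow> t = y i \<Longrightarrow> Suc (hamming d y (x(i := t))) = hamming d y x"
    and "y i \<noteq> x i \<Longrightarrow> t \<noteq> y i \<Longrightarrow> hamming d y (x(i := t)) = hamming d y x"
proof -
  let ?D = "{j. j < d \<and> y j \<noteq> x j}" and ?D' = "{j. j < d \<and> y j \<noteq> (x(i := t)) j}"
  have fin: "finite ?D" by simp
  {
    assume "y i = x i"
    then have "?D' = insert i ?D" "i \<notin> ?D" using i t by auto
    then show "hamming d y (x(i := t)) = Suc (hamming d y x)" using fin by (simp add: hamming_def)
  next
    assume "y i \<noteq> x i" "t = y i"
    then have "?D = insert i ?D'" "i \<notin> ?D'" using i t by auto
    then show "Suc (hamming d y (x(i := t))) = hamming d y x"
      unfolding hamming_def by (metis (no_types, lifting) card_insert_disjoint fin finite_insert)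
  next
    assume "y i \<noteq> x i" "t \<noteq> y i"
    then have "?D' = ?D" using i t by auto
    then show "hamming d y (x(i := t)) = hamming d y x" by (simp add: hamming_def)
  }
qed

text \<open>A pair of a coordinate and a new letter encodes a neighbour of \<open>x\<close>, so that
  neighbours can be counted and summed over as pairs.\<close>

definition changes :: "nat \<Rightarrow> nat \<Rightarrow> (nat \<Rightarrow> nat) \<Rightarrow> (nat \<times> nat) set" where
  "changes d q x = (SIGMA i:{..<d}. {..<q} - {x i})"

lemma changes_inj: "inj_on (\<lambda>(i, t). x(i := t)) (changes d q x)"
proof (rule inj_onI, clarify)
  fix i t i' t' assume *: "(i, t) \<in> changes d q x" "(i', t') \<in> changes d q x" "x(i := t) = x(i' := t')"
  have "i = i'"
  proof (rule ccontr)
    assume "i \<noteq> i'"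
    then have "t = x i" using fun_cong[OF *(3), of i] by simp
    then show False using * by (simp add: changes_def)
  qed
  then show "i = i' \<and> t = t'" using fun_cong[OF *(3), of i] by simp
qed

lemma hamming_neighbours:
  assumes x: "x \<in> words d q"
  shows "{z \<in> words d q. hamming d x z = 1} = (\<lambda>(i, t). x(i := t)) ` changes d q x"
proof (intro equalityI subsetI)
  fix z assume z: "z \<in> {z \<in> words d q. hamming d x z = 1}"
  then have "card {j. j < d \<and> x j \<noteq> z j} = 1" by (simp add: hamming_def)
  then obtain i where i: "{j. j < d \<and> x j \<noteq> z j} = {i}" by (rule card_1_singletonE)
  then have iff: "j < d \<and> x j \<noteq> z j \<longleftrightarrow> j = i" for j by (simp add: set_eq_iff)
  have id: "i < d" "z i \<noteq> x i" using iff[of i] by auto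
  moreover have "z = x(i := z i)"
  proof (rule words_eqI)
    show "x(i := z i) \<in> words d q" using words_update[OF x id(1)] words_less[of z d q i] z id by simp
    show "z j = (x(i := z i)) j" if "j < d" for j
      using iff[of j] that by auto
  qed (use z in simp)
  ultimately show "z \<in> (\<lambda>(i, t). x(i := t)) ` changes d q x"
    using z words_less[of z d q i] by (intro image_eqI[of _ _ "(i, z i)"]) (simp_all add: changes_def)
next
  fix z assume "z \<in> (\<lambda>(i, t). x(i := t)) ` changes d q x"
  then obtain i t where it: "z = x(i := t)" "i < d" "t < q" "t \<noteq> x i" by (auto simp: changes_def)
  have "hamming d x x = 0" by (simp add: hamming_def)
  then show "z \<in> {z \<in> words d q. hamming d x z = 1}"
    using hamming_update(1)[of i d t x x] it words_update[OF x] by simp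
qed

text \<open>A step towards \<open>y\<close> copies a letter of \<open>y\<close> at a differing
  coordinate; a step keeping the distance puts one of the \<open>q - 2\<close> remaining letters
  there; a step away changes an agreeing coordinate in \<open>q - 1\<close> ways.\<close>

lemma
  assumes x: "x \<in> words d q" and y: "y \<in> words d q"
  shows hamming_card_c:
      "card {z \<in> words d q. hamming d x z = 1 \<and> hamming d y z + 1 = hamming d y x} = hamming d y x"
    and hamming_card_a:
      "card {z \<in> words d q. hamming d x z = 1 \<and> hamming d y z = hamming d y x}
        = hamming d y x * (q - 2)"
    and hamming_card_b:
      "card {z \<in> words d q. hamming d x z = 1 \<and> hamming d y z = hamming d y x + 1}
        = (d - hamming d y x) * (q - 1)"
proof -
  let ?D = "{i. i < d \<and> y i \<noteq> x i}"
  have *: "card {z \<in> words d q. hamming d x z = 1 \<and> P (hamming d y z)}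
      = card {(i, t) \<in> changes d q x. P (hamming d y (x(i := t)))}" for P
  proof -
    have "{z \<in> words d q. hamming d x z = 1 \<and> P (hamming d y z)}
      = {z \<in> words d q. hamming d x z = 1} \<inter> {z. P (hamming d y z)}" by auto
    also have "\<dots> = (\<lambda>(i, t). x(i := t)) ` {(i, t) \<in> changes d q x. P (hamming d y (x(i := t)))}"
      unfolding hamming_neighbours[OF x] by auto
    finally show ?thesis
      using inj_on_subset[OF changes_inj[of x d q]] by (simp add: card_image subset_iff)
  qed
  have "{(i, t) \<in> changes d q x. hamming d y (x(i := t)) + 1 = hamming d y x} = (SIGMA i:?D. {y i})"
    using hamming_update[of _ d _ x y] words_less[OF y] by (auto simp: changes_def) fastforce+
  then show "card {z \<in> words d q. hamming d x z = 1 \<and> hamming d y z + 1 = hamming d y x} = hamming d y x"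
    unfolding *[of "\<lambda>h. h + 1 = hamming d y x"] by (simp add: hamming_def)
  have "{(i, t) \<in> changes d q x. hamming d y (x(i := t)) = hamming d y x}
      = (SIGMA i:?D. {..<q} - {x i, y i})"
    using hamming_update[of _ d _ x y] by (auto simp: changes_def) fastforce+
  moreover have "card ({..<q} - {x i, y i}) = q - 2" if "i \<in> ?D" for i
    using that words_less[OF x] words_less[OF y] by (subst card_Diff_subset) auto
  ultimately show "card {z \<in> words d q. hamming d x z = 1 \<and> hamming d y z = hamming d y x}
        = hamming d y x * (q - 2)"
    unfolding *[of "\<lambda>h. h = hamming d y x"] by (simp add: hamming_def)
  have "{(i, t) \<in> changes d q x. hamming d y (x(i := t)) = hamming d y x + 1}
      = (SIGMA i:{..<d} - ?D. {..<q} - {x i})"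
    using hamming_update[of _ d _ x y] by (auto simp: changes_def) fastforce+
  moreover have "card ({..<q} - {x i}) = q - 1" if "i < d" for i
    using that words_less[OF x] by (subst card_Diff_subset) auto
  moreover have "card ({..<d} - ?D) = d - card ?D"
    by (subst card_Diff_subset) auto
  ultimately show "card {z \<in> words d q. hamming d x z = 1 \<and> hamming d y z = hamming d y x + 1}
        = (d - hamming d y x) * (q - 1)"
    unfolding *[of "\<lambda>h. h = hamming d y x + 1"] by (simp add: hamming_def)
qed

lemma hamming_step:
  assumes "x \<in> words d q" "z \<in> words d q" "hamming d x z = 1"
  shows "hamming d y z \<le> hamming d y x + 1"
proof -
  obtain i t where it: "z = x(i := t)" "i < d" "t \<noteq> x i"
    using hamming_neighbours[OF assms(1)] assms(2,3) unfolding changes_def by fastforce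
  then show ?thesis
    using hamming_update[of i d t x y] by (cases "y i = x i"; cases "t = y i") auto
qed

lemma hamming_pred:
  assumes x: "x \<in> words d q" and y: "y \<in> words d q" and h: "hamming d y x = Suc l"
  obtains z where "z \<in> words d q" "hamming d x z = 1" "hamming d y z = l"
proof -
  have "{i. i < d \<and> y i \<noteq> x i} \<noteq> {}" using h unfolding hamming_def by (metis card.empty nat.distinct(1))
  then obtain i where i: "i < d" "y i \<noteq> x i" by auto
  then have "(i, y i) \<in> changes d q x" using words_less[OF y] by (simp add: changes_def)
  then have "x(i := y i) \<in> {z \<in> words d q. hamming d x z = 1}"
    unfolding hamming_neighbours[OF x] by force
  with that show ?thesis using hamming_update(2)[of i d "y i" x y] i h by auto
qed

section \<open>The Hamming graph and two of its eigenvalues\<close>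

text \<open>The words are numbered by \<open>e\<close> because the hypothesis on
  \<open>\<epsilon>\<close> and \<open>\<eta>\<close> concerns graphs whose vertices are natural
  numbers.\<close>

locale hamming_graph =
  fixes d q N :: nat and e :: "nat \<Rightarrow> nat \<Rightarrow> nat"
  assumes d: "1 \<le> d" and q: "2 \<le> q" and e: "bij_betw e {..<N} (words d q)"
begin

definition H :: "nat pair_pre_digraph" where
  "H = \<lparr>pverts = {..<N}, parcs = {(u, v). u < N \<and> v < N \<and> hamming d (e u) (e v) = 1}\<rparr>"

lemma H_simps [simp]: "pverts H = {..<N}"
  "(u, v) \<in> parcs H \<longleftrightarrow> u < N \<and> v < N \<and> hamming d (e u) (e v) = 1"
  by (auto simp: H_def)

lemma e_words: "u < N \<Longrightarrow> e u \<in> words d q"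
  using e by (auto simp: bij_betw_def)

lemma e_eq_iff: "u < N \<Longrightarrow> v < N \<Longrightarrow> e u = e v \<longleftrightarrow> u = v"
  using e by (auto simp: bij_betw_def inj_on_def)

lemma e_surj: "z \<in> words d q \<Longrightarrow> \<exists>u<N. e u = z"
proof -
  assume "z \<in> words d q"
  then have "z \<in> e ` {..<N}" using e by (simp add: bij_betw_def)
  then show ?thesis by auto
qed

lemma pair_graph_H: "pair_graph H"
proof
  show "finite (parcs H)"
    by (rule finite_subset[of _ "{..<N} \<times> {..<N}"]) (auto simp: H_def)
  show "symmetric (with_proj H)"
    by (auto simp: symmetric_def sym_def hamming_sym)
  show "fst a \<noteq> snd a" if "a \<in> parcs H" for a
    using that by (cases a) (auto simp: hamming_def)
qed (auto simp: H_def)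

interpretation pair_graph H by (rule pair_graph_H)

lemma
  assumes u: "u < N" and v: "v < N"
  shows walk_H: "(u, v) \<in> parcs H ^^ hamming d (e u) (e v)"
    and dist_H: "graph_dist H u v = hamming d (e u) (e v)"
proof -
  have zero: "hamming d (e u) (e v) = 0 \<longleftrightarrow> u = v" if "v \<in> pverts H" for v
    using that u e_words e_eq_iff hamming_0_iff[of "e u" d q "e v"] by simp
  have step: "hamming d (e u) (e v) \<le> hamming d (e u) (e w) + 1" if "(w, v) \<in> parcs H" for v w
    using that e_words by (intro hamming_step[of _ _ q]) auto
  have pred: "\<exists>w. (w, v) \<in> parcs H \<and> hamming d (e u) (e w) = l"
    if "v \<in> pverts H" "hamming d (e u) (e v) = Suc l" for v l
  proof -
    have v: "v < N" and h: "hamming d (e u) (e v) = Suc l" using that by simp_all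
    obtain z where "z \<in> words d q" "hamming d (e v) z = 1" "hamming d (e u) z = l"
      using hamming_pred[OF e_words[OF v] e_words[OF u] h] .
    then show ?thesis using e_surj[of z] that hamming_sym by auto
  qed
  show "(u, v) \<in> parcs H ^^ hamming d (e u) (e v)"
    using graph_dist_eqI(1)[of "\<lambda>v. hamming d (e u) (e v)" u v] zero step pred u v by simp
  show "graph_dist H u v = hamming d (e u) (e v)"
    using graph_dist_eqI(2)[of "\<lambda>v. hamming d (e u) (e v)" u v] zero step pred u v by simp
qed

lemma card_neighbours_H:
  assumes v: "v < N" and w: "w < N"
  shows "card {u. (w, u) \<in> parcs H \<and> P (graph_dist H v u)}
    = card {z \<in> words d q. hamming d (e w) z = 1 \<and> P (hamming d (e v) z)}"
proof (rule bij_betw_same_card)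
  show "bij_betw e {u. (w, u) \<in> parcs H \<and> P (graph_dist H v u)}
      {z \<in> words d q. hamming d (e w) z = 1 \<and> P (hamming d (e v) z)}"
    unfolding bij_betw_def
  proof
    show "inj_on e {u. (w, u) \<in> parcs H \<and> P (graph_dist H v u)}"
      using e_eq_iff by (auto simp: inj_on_def)
    show "e ` {u. (w, u) \<in> parcs H \<and> P (graph_dist H v u)}
      = {z \<in> words d q. hamming d (e w) z = 1 \<and> P (hamming d (e v) z)}"
    proof (intro equalityI subsetI)
      fix z assume "z \<in> e ` {u. (w, u) \<in> parcs H \<and> P (graph_dist H v u)}"
      then obtain u where "z = e u" "u < N" "hamming d (e w) z = 1" "P (graph_dist H v u)" by auto
      then show "z \<in> {z \<in> words d q. hamming d (e w) z = 1 \<and> P (hamming d (e v) z)}"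
        using e_words dist_H[OF v] by simp
    next
      fix z assume z: "z \<in> {z \<in> words d q. hamming d (e w) z = 1 \<and> P (hamming d (e v) z)}"
      then obtain u where "u < N" "e u = z" using e_surj by blast
      then show "z \<in> e ` {u. (w, u) \<in> parcs H \<and> P (graph_dist H v u)}"
        using z w dist_H[OF v] by (intro image_eqI[of _ _ u]) auto
    qed
  qed
qed

lemma diameter_H: "graph_diameter H = d"
proof -
  have const: "(\<lambda>i\<in>{..<d}. s) \<in> words d q" if "s < q" for s
    using that by (auto simp: words_def)
  \<comment> \<open>The constant words 0 and 1, available since \<open>q \<ge> 2\<close>, differ in
    all \<open>d\<close> coordinates.\<close>
  obtain u where u: "u < N" "e u = (\<lambda>i\<in>{..<d}. 0)" using e_surj[OF const[of 0]] q by auto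
  obtain v where v: "v < N" "e v = (\<lambda>i\<in>{..<d}. 1)" using e_surj[OF const[of 1]] q by auto
  have "{i. i < d \<and> e u i \<noteq> e v i} = {..<d}" using u v by auto
  then have uv: "graph_dist H u v = d" using u v by (simp add: dist_H hamming_def)
  have "{graph_dist H u v |u v. u \<in> pverts H \<and> v \<in> pverts H} \<subseteq> {..d}"
    using hamming_le by (auto simp: dist_H)
  moreover from this have "finite {graph_dist H u v |u v. u \<in> pverts H \<and> v \<in> pverts H}"
    using finite_subset by blast
  ultimately show ?thesis
    unfolding graph_diameter_def using u v uv by (intro Max_eqI) force+
qed

lemma distance_regular_H:
  "distance_regular H d (\<lambda>i. i * (q - 2)) (\<lambda>i. (d - i) * (q - 1)) (\<lambda>i. i)"
proof -
  have "(\<lambda>i\<in>{..<d}. 0) \<in> words d q" using q by (auto simp: words_def)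
  then have "pverts H \<noteq> {}" using e_surj by auto
  then have "connected (with_proj H)"
    unfolding connected_iff_relpow using walk_H by auto
  moreover have "card {u. (w, u) \<in> parcs H \<and> graph_dist H v u + 1 = i} = i
      \<and> card {u. (w, u) \<in> parcs H \<and> graph_dist H v u = i} = i * (q - 2)
      \<and> card {u. (w, u) \<in> parcs H \<and> graph_dist H v u = i + 1} = (d - i) * (q - 1)"
    if "v \<in> pverts H" "w \<in> pverts H" "graph_dist H v w = i" for i v w
  proof -
    have v: "v < N" and w: "w < N" using that by simp_all
    have i: "hamming d (e v) (e w) = i" using that dist_H[OF v w] by simp
    show ?thesis
      unfolding card_neighbours_H[OF v w, of "\<lambda>h. h + 1 = i"]
        card_neighbours_H[OF v w, of "\<lambda>h. h = i"] card_neighbours_H[OF v w, of "\<lambda>h. h = i + 1"]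
      using hamming_card_c[OF e_words[OF w] e_words[OF v]]
        hamming_card_a[OF e_words[OF w] e_words[OF v]]
        hamming_card_b[OF e_words[OF w] e_words[OF v]]
      unfolding i by (intro conjI)
  qed
  ultimately show ?thesis
    unfolding distance_regular_def using pair_graph_H diameter_H by blast
qed

lemma sum_neighbours_H:
  fixes g :: "(nat \<Rightarrow> nat) \<Rightarrow> real"
  assumes u: "u < N"
  shows "(\<Sum>v\<in>{v \<in> pverts H. (u, v) \<in> parcs H}. g (e v))
    = (\<Sum>i<d. \<Sum>t\<in>{..<q} - {e u i}. g ((e u)(i := t)))"
proof -
  have img: "e ` {v \<in> pverts H. (u, v) \<in> parcs H} = {z \<in> words d q. hamming d (e u) z = 1}"
    using e_words e_surj u by (auto simp: image_iff)
  have inj: "inj_on e {v \<in> pverts H. (u, v) \<in> parcs H}"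
    using e_eq_iff by (auto simp: inj_on_def)
  have "(\<Sum>v\<in>{v \<in> pverts H. (u, v) \<in> parcs H}. g (e v)) = (\<Sum>z\<in>{z \<in> words d q. hamming d (e u) z = 1}. g z)"
    unfolding img[symmetric] by (simp add: sum.reindex[OF inj] del: H_simps)
  also have "\<dots> = (\<Sum>(i, t)\<in>changes d q (e u). g ((e u)(i := t)))"
    unfolding hamming_neighbours[OF e_words[OF u]] sum.reindex[OF changes_inj]
    by (simp add: case_prod_beta')
  also have "\<dots> = (\<Sum>i<d. \<Sum>t\<in>{..<q} - {e u i}. g ((e u)(i := t)))"
    unfolding changes_def by (subst sum.Sigma) auto
  finally show ?thesis .
qed

lemma valency_eigenvalue_H: "eigenvalue (adj_matrix H) (d * (q - 1))"
proof -
  have "(\<lambda>i\<in>{..<d}. 0) \<in> words d q" using q by (auto simp: words_def)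
  then obtain x where x: "x < N" using e_surj by blast
  show ?thesis
  proof (rule eigenvalue_adj_matrixI[where g = "\<lambda>_. 1" and x = x])
    fix u assume "u \<in> pverts H"
    then have u: "u < N" by simp
    have "(\<Sum>t\<in>{..<q} - {e u i}. 1) = real (q - 1)" if "i < d" for i
      using words_less[OF e_words[OF u] that] by (simp add: card_Diff_subset)
    then show "(\<Sum>v\<in>{v \<in> pverts H. (u, v) \<in> parcs H}. 1) = real (d * (q - 1)) * 1"
      unfolding sum_neighbours_H[OF u, of "\<lambda>_. 1"] by simp
  qed (use x in auto)
qed

text \<open>Take a function \<open>f\<close> of the letter at coordinate 0 whose sum over the
  alphabet is 0. Changing that coordinate contributes \<open>- f\<close>, and each of the other
  \<open>d - 1\<close> coordinates contributes \<open>(q - 1) * f\<close>.\<close>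

lemma second_eigenvalue_H: "eigenvalue (adj_matrix H) ((real d - 1) * (real q - 1) - 1)"
proof -
  define f :: "nat \<Rightarrow> real" where "f t = of_bool (t = 0) - of_bool (t = 1)" for t
  have "(\<lambda>i\<in>{..<d}. 0) \<in> words d q" using q by (auto simp: words_def)
  then obtain x where x: "x < N" "e x = (\<lambda>i\<in>{..<d}. 0)" using e_surj by blast
  have total: "(\<Sum>t<q. f t) = 0"
    using q by (simp add: f_def sum_subtractf of_bool_def)
  show ?thesis
  proof (rule eigenvalue_adj_matrixI[where g = "\<lambda>v. f (e v 0)" and x = x])
    fix u assume "u \<in> pverts H"
    then have u: "u < N" by simp
    have less: "e u i < q" if "i < d" for i using words_less[OF e_words[OF u] that] .
    obtain d' where d': "d = Suc d'" using d by (cases d) auto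
    define h where "h i = (\<Sum>t\<in>{..<q} - {e u i}. f (((e u)(i := t)) 0))" for i
    have h0: "h 0 = - f (e u 0)"
      using total less[of 0] d by (simp add: h_def sum_diff1)
    have hS: "h (Suc i) = (real q - 1) * f (e u 0)" if "i < d'" for i
      using less[of "Suc i"] that d' q by (simp add: h_def card_Diff_subset of_nat_diff)
    have "(\<Sum>v\<in>{v \<in> pverts H. (u, v) \<in> parcs H}. f (e v 0)) = (\<Sum>i<d. h i)"
      unfolding sum_neighbours_H[OF u, of "\<lambda>z. f (z 0)"] h_def ..
    also have "\<dots> = h 0 + (\<Sum>i<d'. h (Suc i))"
      unfolding d' by (rule sum.lessThan_Suc_shift)
    also have "\<dots> = - f (e u 0) + real d' * ((real q - 1) * f (e u 0))"
      using h0 hS by simp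
    also have "\<dots> = ((real d - 1) * (real q - 1) - 1) * f (e u 0)"
      using d' by (simp add: algebra_simps)
    finally show "(\<Sum>v\<in>{v \<in> pverts H. (u, v) \<in> parcs H}. f (e v 0))
        = ((real d - 1) * (real q - 1) - 1) * f (e u 0)" .
  qed (use x d in \<open>auto simp: f_def\<close>)
qed

lemma zero_weight_spectral_radius_H:
  "(real d - 1) * (real q - 1) - 1 \<le> zero_weight_spectral_radius H"
proof -
  have "(real d - 1) * (real q - 1) - 1 < real (d * (q - 1))"
    using q by (simp add: of_nat_diff algebra_simps)
  from abs_le_zero_weight_spectral_radius[OF second_eigenvalue_H valency_eigenvalue_H this]
  show ?thesis by simp
qed

end

section \<open>The constraint on \<open>\<eta>\<close> and the motion bound\<close>

lemma spectral_gap_le: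
  fixes \<epsilon> \<eta> :: real
  assumes d: "1 \<le> d" and \<epsilon>: "0 < \<epsilon>" and \<eta>: "0 < \<eta>"
    and gap: "\<And>(G :: nat pair_pre_digraph) a b c. distance_regular G d a b c \<Longrightarrow>
      (\<exists>i<d. real (b i) \<ge> \<epsilon> * real (b 0) \<and> real (c (i + 1)) \<ge> \<epsilon> * real (b 0)) \<or>
      zero_weight_spectral_radius G \<le> real (b 0) * (1 - \<eta>)"
  shows "\<eta> * d \<le> 2"
proof -
  \<comment> \<open>With \<open>q - 1 = r + 1 > 1 / \<epsilon>\<close>, every
    \<open>c (i + 1) = i + 1 \<le> d\<close> lies below \<open>\<epsilon> * d * (q - 1)\<close>,
    which is \<open>\<epsilon>\<close> times the valency; the first alternative fails.\<close>
  obtain r :: nat where r: "1 / \<epsilon> < r" using reals_Archimedean2 by blast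
  define q where "q = r + 2"
  have "finite (words d q)" by (simp add: words_def finite_PiE)
  then obtain e where "bij_betw e {..<card (words d q)} (words d q)"
    using ex_bij_betw_nat_finite lessThan_atLeast0 by metis
  then interpret hamming_graph d q "card (words d q)" e
    using d by unfold_locales (auto simp: q_def)
  have "1 < \<epsilon> * (r + 1)" using r \<epsilon> by (simp add: field_simps)
  then have "1 * real d < \<epsilon> * (r + 1) * real d" using d by (intro mult_strict_right_mono) auto
  then have "\<not> (\<exists>i<d. real (i + 1) \<ge> \<epsilon> * real (d * (q - 1)))"
    by (auto simp: q_def algebra_simps)
  then have "zero_weight_spectral_radius H \<le> real (d * (q - 1)) * (1 - \<eta>)"
    using gap[OF distance_regular_H] by auto
  then have "(real d - 1) * (real q - 1) - 1 \<le> real d * (real q - 1) * (1 - \<eta>)"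
    using zero_weight_spectral_radius_H by (simp add: q_def algebra_simps)
  \<comment> \<open>The terms \<open>d * (q - 1)\<close> cancel, leaving
    \<open>\<eta> * d * (q - 1) \<le> q\<close>.\<close>
  then have "\<eta> * d * (r + 1) \<le> r + 2" by (simp add: q_def algebra_simps)
  also have "\<dots> \<le> 2 * real (r + 1)" by simp
  finally show ?thesis by (rule mult_right_le_imp_le) simp
qed

theorem theorem5p7:
  fixes d t :: nat and \<epsilon> \<eta> m :: real
    and X :: "'a pair_pre_digraph" and a b c :: "nat \<Rightarrow> nat"
  assumes "d \<ge> 2" and "\<epsilon> > 0" and "0 < \<eta>" and "\<eta> < 1 / 2"
    and "\<And>(G :: nat pair_pre_digraph) a' b' c'. distance_regular G d a' b' c' \<Longrightarrow>
           (\<exists>i<d. real (b' i) \<ge> \<epsilon> * real (b' 0) \<and> real (c' (i + 1)) \<ge> \<epsilon> * real (b' 0)) \<or>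
           zero_weight_spectral_radius G \<le> real (b' 0) * (1 - \<eta>)"
    and "distance_regular X d a b c" and "geometric X (b 0)"
    and "c 2 = 1"
    and "smallest_eigenvalue X = - m" and "m \<ge> 3"
    and "t \<in> {1..d}" and "real (c t) \<le> \<epsilon> * real (b 0)" and "real (b t) \<le> \<epsilon> * real (b 0)"
    and "real (b 0) \<ge> max (4 * m / \<eta>) (m ^ 2)"
  shows "ereal_of_enat (motion X) \<ge> ereal (\<eta> / 4 * real (card (pverts X)))"
proof -
  note d = assms(1) and \<epsilon> = assms(2) and \<eta> = assms(3,4) and gap = assms(5) and k = assms(14)
  interpret drg_mu1 X d a b c
    by unfold_locales (fact assms(6), fact assms(1), fact assms(8))
  have "\<eta> * d \<le> 2"
  proof (rule spectral_gap_le[OF _ \<epsilon> \<eta>(1)])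
    show "1 \<le> d" using d by simp
  qed (rule gap)
  \<comment> \<open>The number 12 is \<open>4 * 3\<close>, matching \<open>m \<ge> 3\<close> in the
    lower bound \<open>4 * m / \<eta>\<close> for the valency.\<close>
  then have "6 * d \<le> 12 / \<eta>" using \<eta> by (simp add: field_simps)
  also have "\<dots> \<le> 4 * m / \<eta>" using \<eta> assms(10) by (intro divide_right_mono) auto
  also have "\<dots> \<le> b 0" using k by simp
  finally have k6: "6 * d \<le> b 0" by (simp only: of_nat_le_iff)
  \<comment> \<open>Half of \<open>card V\<close> is rounded up, since the bound passes through
    \<open>enat\<close>. Taking it below every term of the infimum also covers a trivial
    automorphism group.\<close>
  define K where "K = (card V + 1) div 2"
  have "enat K \<le> motion X"
    unfolding motion_def
  proof (rule INF_greatest)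
    fix \<sigma> assume \<sigma>: "\<sigma> \<in> graph_automorphisms X - {id}"
    then interpret drg_mu1_aut X d a b c \<sigma> by unfold_locales simp
    obtain v where "\<sigma> v \<noteq> v" using \<sigma> by (auto simp: fun_eq_iff)
    moreover from this have "v \<in> V"
      using \<sigma> by (auto simp: graph_automorphisms_def permutes_def)
    ultimately have "moved \<noteq> {}" by (auto simp: moved_def)
    then show "enat K \<le> enat (card {v \<in> V. \<sigma> v \<noteq> v})"
      using half_moved[OF k6] by (simp add: K_def moved_def)
  qed
  then have "ereal K \<le> ereal_of_enat (motion X)"
    by (simp only: ereal_of_enat_le_iff flip: ereal_of_enat_simps(1))
  moreover have "\<eta> / 4 * card V \<le> K"
  proof -
    have "\<eta> / 4 * card V \<le> 1 / 2 * card V"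
      using \<eta> by (intro mult_right_mono) auto
    also have "\<dots> \<le> K" by (simp add: K_def)
    finally show ?thesis .
  qed
  ultimately show ?thesis
    by (meson ereal_less_eq(3) order_trans)
qed

end
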